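(* Let $R$ be an $\mathbb{N}$-graded algebra over a field $\mathbb{K}$ and let $A=\sigma(R)\langle x_1,\dots,x_n\rangle$ be a graded quasi-commutative skew PBW extension of $R$. Then $A$ is isomorphic to a graded iterated Ore extension of endomorphism type of $R$.
   Context: All algebras are $\mathbb{K}$-algebras over a field $\mathbb{K}$; $\mathbb{N}$ includes $0$. Skew PBW extension: for rings $R\subseteq A$, $A=\sigma(R)\langle x_1,\dots,x_n\rangle$ is a skew PBW extension of $R$ if (1) $A$ is a free left $R$-module with basis the monomials $x_1^{\alpha_1}\cdots x_n^{\alpha_n}$, $\alpha\in\mathbb{N}^n$; (2) for each $i$ and each $0\ne r\in R$ there is $0\neq c_{i,r}\in R$ with $x_ir-c_{i,r}x_i\in R$; (3) for all $1\le i,j\le n$ there is $0\ne c_{i,j}\in R$ with $x_jx_i-c_{i,j}x_ix_j\in R+Rx_1+\cdots+Rx_n$. Then the $c_{i,j}$ are unique, $c_{i,i}=1$, and there are injective ring endomorphisms $\sigma_i$ of $R$ and $\sigma_i$-derivations $\delta_i$ of $R$ with $x_ir=\sigma_i(r)x_i+\delta_i(r)$ for all $r\in R$. $A$ is quasi-commutative if (2) and (3) hold in the stronger form $x_ir=c_{i,r}x_i$ and $x_jx_i=c_{i,j}x_ix_j$ (so $\delta_i=0$). $A$ is bijective if every $\sigma_i$ is bijective and $c_{i,j}$ is invertible for all $1\le i<j\le n$. Graded skew PBW extension: let $R=\bigoplus_{m\ge 0}R_m$ be $\mathbb{N}$-graded. A bijective skew PBW extension $A$ of $R$ is graded if each $\sigma_i$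 is a graded ring homomorphism, each $\delta_i:R(-1)\to R$ is a graded $\sigma_i$-derivation, and for all $i,j$, $c_{i,j}\in R_0$ and $x_jx_i-c_{i,j}x_ix_j\in R_2+R_1x_1+\cdots+R_1x_n$. Then $A$ is $\mathbb{N}$-graded with $A_p$ spanned by the $rx^\alpha$ with $r\in R_t$, $t+|\alpha|=p$. Graded iterated Ore extension of endomorphism type of $R$: an iterated Ore extension $R[z_1;\theta_1]\cdots[z_m;\theta_m]$ with zero derivations, in which each $z_j$ has degree $1$ and each $\theta_j$ is a graded algebra automorphism of $R[z_1;\theta_1]\cdots[z_{j-1};\theta_{j-1}]$; here $z_ja=\theta_j(a)z_j$ for $a\in R[z_1;\theta_1]\cdots[z_{j-1};\theta_{j-1}]$. *)

theory Defs
  imports "HOL-Algebra.Module"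
begin

section \<open>Algebras, gradings, bases\<close>

text \<open>The library locale \<^locale>\<open>algebra\<close> is restricted to commutative algebras, and
  \<^locale>\<open>module\<close> to modules over commutative rings. Hence the notions below.\<close>

locale k_algebra = K: field K + M: module K A + A: ring A
  for K :: "('k, 'l) ring_scheme" and A :: "('k, 'a) module" +
  assumes smult_mult_left:
      "\<lbrakk>k \<in> carrier K; a \<in> carrier A; b \<in> carrier A\<rbrakk> \<Longrightarrow>
        (k \<odot>\<^bsub>A\<^esub> a) \<otimes>\<^bsub>A\<^esub> b = k \<odot>\<^bsub>A\<^esub> (a \<otimes>\<^bsub>A\<^esub> b)"
    and smult_mult_right:
      "\<lbrakk>k \<in> carrier K; a \<in> carrier A; b \<in> carrier A\<rbrakk> \<Longrightarrow>
        a \<otimes>\<^bsub>A\<^esub> (k \<odot>\<^bsub>A\<^esub> b) = k \<odot>\<^bsub>A\<^esub> (a \<otimes>\<^bsub>A\<^esub> b)"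

definition alg_hom ::
    "('k, 'l) ring_scheme \<Rightarrow> ('k, 'a) module \<Rightarrow> ('k, 'b) module \<Rightarrow> ('a \<Rightarrow> 'b) set" where
  "alg_hom K A B = {f \<in> ring_hom A B.
     \<forall>k\<in>carrier K. \<forall>a\<in>carrier A. f (k \<odot>\<^bsub>A\<^esub> a) = k \<odot>\<^bsub>B\<^esub> f a}"

text \<open>\<open>R\<close> and \<open>A\<close> are separate records over one element type; \<open>R \<subseteq> A\<close> as algebras means that
  the inclusion is a (unital) algebra homomorphism.\<close>

definition subalg ::
    "('k, 'l) ring_scheme \<Rightarrow> ('k, 'a) module \<Rightarrow> ('k, 'a) module \<Rightarrow> bool" where
  "subalg K R A \<longleftrightarrow> k_algebra K R \<and> k_algebra K A \<and>
     carrier R \<subseteq> carrier A \<and> (\<lambda>a. a) \<in> alg_hom K R A"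

definition lin_span ::
    "('k, 'l) ring_scheme \<Rightarrow> ('k, 'a) module \<Rightarrow> 'a set \<Rightarrow> 'a set" where
  "lin_span K A X = \<Inter>{H. submodule H K A \<and> X \<subseteq> H}"

text \<open>\<open>A\<close> is the internal direct sum of the subspaces \<open>gr m\<close>. That the identity has degree \<open>0\<close>
  is automatic for gradings by the natural numbers.\<close>

locale graded_algebra = k_algebra K A
  for K :: "('k, 'l) ring_scheme" and A :: "('k, 'a) module" +
  fixes gr :: "nat \<Rightarrow> 'a set"
  assumes subspace: "submodule (gr m) K A"
    and sum_components:
      "a \<in> carrier A \<Longrightarrow> \<exists>d. \<exists>f \<in> (\<Pi> m\<in>{..d}. gr m). a = (\<Oplus>\<^bsub>A\<^esub>m\<in>{..d}. f m)"
    and independent_components: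
      "\<lbrakk>f \<in> (\<Pi> m\<in>{..d}. gr m); (\<Oplus>\<^bsub>A\<^esub>m\<in>{..d}. f m) = \<zero>\<^bsub>A\<^esub>; m \<le> d\<rbrakk> \<Longrightarrow> f m = \<zero>\<^bsub>A\<^esub>"
    and mult_degree:
      "\<lbrakk>a \<in> gr p; b \<in> gr q\<rbrakk> \<Longrightarrow> a \<otimes>\<^bsub>A\<^esub> b \<in> gr (p + q)"

definition graded_alg_iso ::
    "('k, 'l) ring_scheme \<Rightarrow> ('k, 'a) module \<Rightarrow> (nat \<Rightarrow> 'a set) \<Rightarrow>
     ('k, 'b) module \<Rightarrow> (nat \<Rightarrow> 'b set) \<Rightarrow> ('a \<Rightarrow> 'b) set" where
  "graded_alg_iso K A gA B gB = {f \<in> alg_hom K A B.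
     bij_betw f (carrier A) (carrier B) \<and> (\<forall>m. f ` gA m = gB m)}"

text \<open>The family \<open>b\<close>, indexed by \<open>I\<close>, is a basis of \<open>A\<close> as a left \<open>R\<close>-module.\<close>

definition left_basis ::
    "('k, 'a) module \<Rightarrow> ('k, 'a) module \<Rightarrow> 'i set \<Rightarrow> ('i \<Rightarrow> 'a) \<Rightarrow> bool" where
  "left_basis R A I b \<longleftrightarrow> b \<in> I \<rightarrow> carrier A \<and>
     (\<forall>a\<in>carrier A. \<exists>F f. finite F \<and> F \<subseteq> I \<and> f \<in> F \<rightarrow> carrier R \<and>
        a = (\<Oplus>\<^bsub>A\<^esub>i\<in>F. f i \<otimes>\<^bsub>A\<^esub> b i)) \<and>
     (\<forall>F f. finite F \<and> F \<subseteq> I \<and> f \<in> F \<rightarrow> carrier R \<and>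
        (\<Oplus>\<^bsub>A\<^esub>i\<in>F. f i \<otimes>\<^bsub>A\<^esub> b i) = \<zero>\<^bsub>A\<^esub> \<longrightarrow> (\<forall>i\<in>F. f i = \<zero>\<^bsub>R\<^esub>))"

definition skew_derivation ::
    "('k, 'a) module \<Rightarrow> ('a \<Rightarrow> 'a) \<Rightarrow> ('a \<Rightarrow> 'a) \<Rightarrow> bool" where
  "skew_derivation R \<sigma> \<delta> \<longleftrightarrow> \<delta> \<in> carrier R \<rightarrow> carrier R \<and>
     (\<forall>r\<in>carrier R. \<forall>s\<in>carrier R.
        \<delta> (r \<oplus>\<^bsub>R\<^esub> s) = \<delta> r \<oplus>\<^bsub>R\<^esub> \<delta> s \<and>
        \<delta> (r \<otimes>\<^bsub>R\<^esub> s) = \<sigma> r \<otimes>\<^bsub>R\<^esub> \<delta> s \<oplus>\<^bsub>R\<^esub> \<delta> r \<otimes>\<^bsub>R\<^esub> s)"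

section \<open>Skew PBW extensions\<close>

text \<open>The variables are \<open>x 1, \<dots>, x n\<close>; exponent vectors are functions on \<open>{1..n}\<close>,
  made canonical by being \<^const>\<open>undefined\<close> elsewhere.\<close>

definition exponents :: "nat \<Rightarrow> (nat \<Rightarrow> nat) set" where
  "exponents n = {1..n} \<rightarrow>\<^sub>E UNIV"

primrec std_mono :: "('k, 'a) module \<Rightarrow> (nat \<Rightarrow> 'a) \<Rightarrow> nat \<Rightarrow> (nat \<Rightarrow> nat) \<Rightarrow> 'a" where
  "std_mono A x 0 \<alpha> = \<one>\<^bsub>A\<^esub>"
| "std_mono A x (Suc n) \<alpha> = std_mono A x n \<alpha> \<otimes>\<^bsub>A\<^esub> (x (Suc n) [^]\<^bsub>A\<^esub> \<alpha> (Suc n))"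

text \<open>\<open>affine_part A n x S T\<close> is \<open>S + T x\<^sub>1 + \<dots> + T x\<^sub>n\<close>.\<close>

definition affine_part ::
    "('k, 'a) module \<Rightarrow> nat \<Rightarrow> (nat \<Rightarrow> 'a) \<Rightarrow> 'a set \<Rightarrow> 'a set \<Rightarrow> 'a set" where
  "affine_part A n x S T =
     {s \<oplus>\<^bsub>A\<^esub> (\<Oplus>\<^bsub>A\<^esub>i\<in>{1..n}. t i \<otimes>\<^bsub>A\<^esub> x i) | s t. s \<in> S \<and> t \<in> {1..n} \<rightarrow> T}"

definition skew_PBW_extension ::
    "('k, 'l) ring_scheme \<Rightarrow> ('k, 'a) module \<Rightarrow> ('k, 'a) module \<Rightarrow> nat \<Rightarrow> (nat \<Rightarrow> 'a) \<Rightarrow> bool"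
  where
  "skew_PBW_extension K R A n x \<longleftrightarrow>
     subalg K R A \<and> x \<in> {1..n} \<rightarrow> carrier A \<and>
     left_basis R A (exponents n) (std_mono A x n) \<and>
     (\<forall>i\<in>{1..n}. \<forall>r\<in>carrier R - {\<zero>\<^bsub>R\<^esub>}. \<exists>c\<in>carrier R - {\<zero>\<^bsub>R\<^esub>}.
        x i \<otimes>\<^bsub>A\<^esub> r \<ominus>\<^bsub>A\<^esub> c \<otimes>\<^bsub>A\<^esub> x i \<in> carrier R) \<and>
     (\<forall>i\<in>{1..n}. \<forall>j\<in>{1..n}. \<exists>c\<in>carrier R - {\<zero>\<^bsub>R\<^esub>}.
        x j \<otimes>\<^bsub>A\<^esub> x i \<ominus>\<^bsub>A\<^esub> c \<otimes>\<^bsub>A\<^esub> (x i \<otimes>\<^bsub>A\<^esub> x j) \<in> affine_part A n x (carrier R) (carrier R))"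

definition quasi_commutative ::
    "('k, 'a) module \<Rightarrow> ('k, 'a) module \<Rightarrow> nat \<Rightarrow> (nat \<Rightarrow> 'a) \<Rightarrow> bool" where
  "quasi_commutative R A n x \<longleftrightarrow>
     (\<forall>i\<in>{1..n}. \<forall>r\<in>carrier R - {\<zero>\<^bsub>R\<^esub>}. \<exists>c\<in>carrier R - {\<zero>\<^bsub>R\<^esub>}.
        x i \<otimes>\<^bsub>A\<^esub> r = c \<otimes>\<^bsub>A\<^esub> x i) \<and>
     (\<forall>i\<in>{1..n}. \<forall>j\<in>{1..n}. \<exists>c\<in>carrier R - {\<zero>\<^bsub>R\<^esub>}.
        x j \<otimes>\<^bsub>A\<^esub> x i = c \<otimes>\<^bsub>A\<^esub> (x i \<otimes>\<^bsub>A\<^esub> x j))"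

text \<open>The data \<open>\<sigma>\<^sub>i, \<delta>\<^sub>i, c\<^sub>i\<^sub>j\<close> attached to a skew PBW extension.
  By freeness, \<open>\<sigma>\<^sub>i\<close> and \<open>\<delta>\<^sub>i\<close> are determined on \<open>R\<close>, as are the \<open>c\<^sub>i\<^sub>j\<close> in the bijective case,
  so nothing depends on how they are chosen in the existential statement of
  \<open>graded_skew_PBW_extension\<close>.\<close>

definition skew_PBW_data ::
    "('k, 'a) module \<Rightarrow> ('k, 'a) module \<Rightarrow> nat \<Rightarrow> (nat \<Rightarrow> 'a) \<Rightarrow>
     (nat \<Rightarrow> 'a \<Rightarrow> 'a) \<Rightarrow> (nat \<Rightarrow> 'a \<Rightarrow> 'a) \<Rightarrow> (nat \<Rightarrow> nat \<Rightarrow> 'a) \<Rightarrow> bool" where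
  "skew_PBW_data R A n x \<sigma> \<delta> c \<longleftrightarrow>
     (\<forall>i\<in>{1..n}. \<sigma> i \<in> ring_hom R R \<and> inj_on (\<sigma> i) (carrier R) \<and>
        skew_derivation R (\<sigma> i) (\<delta> i) \<and>
        (\<forall>r\<in>carrier R. x i \<otimes>\<^bsub>A\<^esub> r = \<sigma> i r \<otimes>\<^bsub>A\<^esub> x i \<oplus>\<^bsub>A\<^esub> \<delta> i r)) \<and>
     (\<forall>i\<in>{1..n}. \<forall>j\<in>{1..n}. c i j \<in> carrier R - {\<zero>\<^bsub>R\<^esub>} \<and>
        x j \<otimes>\<^bsub>A\<^esub> x i \<ominus>\<^bsub>A\<^esub> c i j \<otimes>\<^bsub>A\<^esub> (x i \<otimes>\<^bsub>A\<^esub> x j)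
          \<in> affine_part A n x (carrier R) (carrier R))"

definition bijective_data ::
    "('k, 'a) module \<Rightarrow> nat \<Rightarrow> (nat \<Rightarrow> 'a \<Rightarrow> 'a) \<Rightarrow> (nat \<Rightarrow> nat \<Rightarrow> 'a) \<Rightarrow> bool" where
  "bijective_data R n \<sigma> c \<longleftrightarrow>
     (\<forall>i\<in>{1..n}. bij_betw (\<sigma> i) (carrier R) (carrier R)) \<and>
     (\<forall>i j. 1 \<le> i \<and> i < j \<and> j \<le> n \<longrightarrow> c i j \<in> Units R)"

definition graded_data ::
    "('k, 'a) module \<Rightarrow> (nat \<Rightarrow> 'a set) \<Rightarrow> nat \<Rightarrow> (nat \<Rightarrow> 'a) \<Rightarrow>
     (nat \<Rightarrow> 'a \<Rightarrow> 'a) \<Rightarrow> (nat \<Rightarrow> 'a \<Rightarrow> 'a) \<Rightarrow> (nat \<Rightarrow> nat \<Rightarrow> 'a) \<Rightarrow> bool" where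
  "graded_data A gr n x \<sigma> \<delta> c \<longleftrightarrow>
     (\<forall>i\<in>{1..n}. \<forall>m. \<sigma> i ` gr m \<subseteq> gr m \<and> \<delta> i ` gr m \<subseteq> gr (Suc m)) \<and>
     (\<forall>i\<in>{1..n}. \<forall>j\<in>{1..n}. c i j \<in> gr 0 \<and>
        x j \<otimes>\<^bsub>A\<^esub> x i \<ominus>\<^bsub>A\<^esub> c i j \<otimes>\<^bsub>A\<^esub> (x i \<otimes>\<^bsub>A\<^esub> x j) \<in> affine_part A n x (gr 2) (gr 1))"

definition graded_skew_PBW_extension ::
    "('k, 'l) ring_scheme \<Rightarrow> ('k, 'a) module \<Rightarrow> (nat \<Rightarrow> 'a set) \<Rightarrow> ('k, 'a) module \<Rightarrow>
     nat \<Rightarrow> (nat \<Rightarrow> 'a) \<Rightarrow> bool" where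
  "graded_skew_PBW_extension K R gr A n x \<longleftrightarrow>
     graded_algebra K R gr \<and> skew_PBW_extension K R A n x \<and>
     (\<exists>\<sigma> \<delta> c. skew_PBW_data R A n x \<sigma> \<delta> c \<and> bijective_data R n \<sigma> c \<and>
        graded_data A gr n x \<sigma> \<delta> c)"

definition skew_PBW_grading ::
    "('k, 'l) ring_scheme \<Rightarrow> (nat \<Rightarrow> 'a set) \<Rightarrow> ('k, 'a) module \<Rightarrow> nat \<Rightarrow> (nat \<Rightarrow> 'a) \<Rightarrow>
     nat \<Rightarrow> 'a set" where
  "skew_PBW_grading K gr A n x p = lin_span K A
     {r \<otimes>\<^bsub>A\<^esub> std_mono A x n \<alpha> | r t \<alpha>. \<alpha> \<in> exponents n \<and> r \<in> gr t \<and> t + (\<Sum>i\<in>{1..n}. \<alpha> i) = p}"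

section \<open>Ore extensions\<close>

text \<open>\<open>C = S[z; \<theta>, \<delta>]\<close>, described intrinsically: \<open>C\<close> contains \<open>S\<close>, is free as a left
  \<open>S\<close>-module on the powers of \<open>z\<close>, and \<open>z a = \<theta>(a) z + \<delta>(a)\<close> for \<open>a\<close> in \<open>S\<close>.
  This determines \<open>C\<close> up to an isomorphism over \<open>S\<close>.\<close>

definition ore_extension ::
    "('k, 'l) ring_scheme \<Rightarrow> ('k, 'a) module \<Rightarrow> ('a \<Rightarrow> 'a) \<Rightarrow> ('a \<Rightarrow> 'a) \<Rightarrow>
     'a \<Rightarrow> ('k, 'a) module \<Rightarrow> bool" where
  "ore_extension K S \<theta> \<delta> z C \<longleftrightarrow>
     subalg K S C \<and> z \<in> carrier C \<and> \<theta> \<in> ring_hom S S \<and> skew_derivation S \<theta> \<delta> \<and>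
     left_basis S C UNIV (\<lambda>k::nat. z [^]\<^bsub>C\<^esub> k) \<and>
     (\<forall>a\<in>carrier S. z \<otimes>\<^bsub>C\<^esub> a = \<theta> a \<otimes>\<^bsub>C\<^esub> z \<oplus>\<^bsub>C\<^esub> \<delta> a)"

text \<open>\<open>graded_iterated_ore_endo K R gr B gB\<close>: for some \<open>m\<close>, the algebra \<open>B\<close> with grading \<open>gB\<close> is
  \<open>R[z\<^sub>1;\<theta>\<^sub>1]\<dots>[z\<^sub>m;\<theta>\<^sub>m]\<close>. The grading of each stage extends the previous one and puts \<open>z\<close> in
  degree \<open>1\<close>; this forces its degree-\<open>p\<close> part to be the span of all \<open>a z\<^sup>k\<close> with
  \<open>a\<close> homogeneous of degree \<open>p - k\<close>.\<close>

inductive graded_iterated_ore_endo ::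
    "('k, 'l) ring_scheme \<Rightarrow> ('k, 'a) module \<Rightarrow> (nat \<Rightarrow> 'a set) \<Rightarrow>
     ('k, 'a) module \<Rightarrow> (nat \<Rightarrow> 'a set) \<Rightarrow> bool"
  for K R gr where
  base: "graded_algebra K R gr \<Longrightarrow> graded_iterated_ore_endo K R gr R gr"
| step: "\<lbrakk>graded_iterated_ore_endo K R gr B gB;
    \<theta> \<in> graded_alg_iso K B gB B gB;
    ore_extension K B \<theta> (\<lambda>_. \<zero>\<^bsub>B\<^esub>) z C;
    graded_algebra K C gC; \<forall>m. gB m \<subseteq> gC m; z \<in> gC 1\<rbrakk>
    \<Longrightarrow> graded_iterated_ore_endo K R gr C gC"

end

theory Submission
  imports Defs "HOL-Algebra.Subrings"
begin

text \<open>
  The isomorphism is the identity: let \<open>A\<^sub>k\<close> be the left \<open>R\<close>-span of the standard monomials in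
  \<open>x\<^sub>1, \<dots>, x\<^sub>k\<close>. Since \<open>x\<^sub>j r = \<sigma>\<^sub>j(r) x\<^sub>j\<close> and \<open>x\<^sub>j x\<^sub>i = c\<^sub>i\<^sub>j x\<^sub>i x\<^sub>j\<close> with \<open>c\<^sub>i\<^sub>j\<close> a unit of degree \<open>0\<close>, reordering
  a product of monomials only costs a unit of degree \<open>0\<close>, so \<open>A\<^sub>k\<close> is a graded subalgebra. By the same
  rules \<open>x\<^sub>k\<^sub>+\<^sub>1 A\<^sub>k = A\<^sub>k x\<^sub>k\<^sub>+\<^sub>1\<close>, and freeness makes both multiplications by \<open>x\<^sub>k\<^sub>+\<^sub>1\<close> injective on \<open>A\<^sub>k\<close>;
  this defines a graded automorphism \<open>\<theta>\<close> of \<open>A\<^sub>k\<close> with \<open>x\<^sub>k\<^sub>+\<^sub>1 a = \<theta>(a) x\<^sub>k\<^sub>+\<^sub>1\<close>, and \<open>A\<^sub>k\<^sub>+\<^sub>1 = A\<^sub>k[x\<^sub>k\<^sub>+\<^sub>1; \<theta>]\<close>.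
\<close>

section \<open>Coordinates with respect to a left basis\<close>

text \<open>Everything is read off from left coordinates in the one basis of \<open>A\<close>. Thus
  independence of the graded parts reduces to independence in \<open>R\<close>, and the reordering
  relations are spent only on closure under products. On terms the automorphism sends
  \<open>r x^\<alpha>\<close> to \<open>\<sigma>(r) u x^\<alpha>\<close>, with a unit
  \<open>u\<close> depending on the monomial. Taking this as the definition would make
  multiplicativity a computation with these units; \<open>twist\<close> is instead the unique
  solution \<open>b\<close> of \<open>x a = b x\<close>, and multiplicativity follows from
  uniqueness. One obstacle is that the data \<sigma>, \<delta>, c and the coefficients supplied by
  quasi-commutativity are separate existential witnesses: freeness forces \<delta> = 0 and
  identifies the constants \<open>c i j\<close> for i < j. Another is that the tower must start at
  the record \<open>R\<close>, whose operations agree with those of \<open>A\<close> only on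
  \<open>carrier R\<close>; the facts about a stage are therefore proved for any subalgebra with the
  right carrier.\<close>

lemma (in abelian_group) finsum_closed_under:
  assumes "finite F" "\<zero> \<in> H" "\<And>a b. a \<in> H \<Longrightarrow> b \<in> H \<Longrightarrow> a \<oplus> b \<in> H" "H \<subseteq> carrier G"
    "\<And>i. i \<in> F \<Longrightarrow> f i \<in> H"
  shows "(\<Oplus>i\<in>F. f i) \<in> H"
  using assms(1,5)
proof (induction F rule: finite_induct)
  case empty
  then show ?case using assms(2) by simp
next
  case (insert j F)
  then have "(\<Oplus>i\<in>insert j F. f i) = f j \<oplus> (\<Oplus>i\<in>F. f i)"
    using assms(4) by (intro finsum_insert) auto
  then show ?case using insert assms(3) by simp
qed

text \<open>Applied to inclusions of rings, to coefficient maps and to additive bijections of graded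
  algebras.\<close>

lemma additive_finsum:
  assumes "abelian_group G" "abelian_group H" "finite F"
    and "\<And>a. a \<in> carrier G \<Longrightarrow> h a \<in> carrier H"
    and "h \<zero>\<^bsub>G\<^esub> = \<zero>\<^bsub>H\<^esub>"
    and "\<And>a b. a \<in> carrier G \<Longrightarrow> b \<in> carrier G \<Longrightarrow> h (a \<oplus>\<^bsub>G\<^esub> b) = h a \<oplus>\<^bsub>H\<^esub> h b"
    and "f \<in> F \<rightarrow> carrier G"
  shows "h (\<Oplus>\<^bsub>G\<^esub>i\<in>F. f i) = (\<Oplus>\<^bsub>H\<^esub>i\<in>F. h (f i))"
proof -
  interpret G: abelian_group G by fact
  interpret H: abelian_group H by fact
  show ?thesis
    using assms(3,7)
  proof (induction F rule: finite_induct)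
    case empty
    then show ?case using assms(5) by simp
  next
    case (insert j F)
    then have "f \<in> F \<rightarrow> carrier G" "f j \<in> carrier G" by auto
    with insert show ?case
      using assms(4,6) by (simp add: Pi_def)
  qed
qed

text \<open>\<open>R\<close> and \<open>A\<close> are separate records, and outside
  \<open>carrier R\<close> the operations of \<open>R\<close> are unconstrained. The simp rules
  below rewrite operations of \<open>R\<close> on its own elements to those of \<open>A\<close>. The
  same locale later serves every stage of the tower.\<close>

locale ring_extension = ring A
  for A :: "('k, 'a) module" (structure) +
  fixes R :: "('k, 'a) module"
  assumes ring_R: "ring R"
    and carrier_R: "carrier R \<subseteq> carrier A"
    and incl_hom: "(\<lambda>a. a) \<in> ring_hom R A"
begin

interpretation R: ring R by (rule ring_R)

lemma R_carrier [simp]: "r \<in> carrier R \<Longrightarrow> r \<in> carrier A"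
  using carrier_R by auto

lemma R_ops [simp]:
  assumes "r \<in> carrier R" "s \<in> carrier R"
  shows "r \<oplus>\<^bsub>R\<^esub> s = r \<oplus> s" "r \<otimes>\<^bsub>R\<^esub> s = r \<otimes> s"
  using assms incl_hom by (auto simp: ring_hom_def)

lemma R_one [simp]: "\<one>\<^bsub>R\<^esub> = \<one>"
  using incl_hom by (auto simp: ring_hom_def)

text \<open>\<open>ring_hom\<close> has no clause about zero, but the zero of \<open>R\<close> is
  additively idempotent in \<open>A\<close>, hence zero there.\<close>

lemma R_zero [simp]: "\<zero>\<^bsub>R\<^esub> = \<zero>"
proof -
  let ?z = "\<zero>\<^bsub>R\<^esub>"
  have z: "?z \<in> carrier R" "?z \<in> carrier A" using R.zero_closed carrier_R by auto
  have "?z \<oplus> ?z = ?z"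
    using R_ops(1)[OF z(1) z(1)] R.l_zero[OF z(1)] by metis
  then show ?thesis
    using add.r_cancel_one[OF z(2) z(2)] by blast
qed

lemma R_a_inv [simp]:
  assumes "r \<in> carrier R"
  shows "\<ominus>\<^bsub>R\<^esub> r = \<ominus> r"
proof -
  have "\<ominus>\<^bsub>R\<^esub> r \<in> carrier R" using assms by (rule R.a_inv_closed)
  then have "\<ominus>\<^bsub>R\<^esub> r \<oplus> r = \<zero>"
    using R.l_neg[OF assms] R_ops(1)[OF _ assms] R_zero by metis
  then show ?thesis
    using minus_equality[of "\<ominus>\<^bsub>R\<^esub> r" r] \<open>\<ominus>\<^bsub>R\<^esub> r \<in> carrier R\<close> assms carrier_R by auto
qed

lemma R_closed [simp, intro]:
  assumes "r \<in> carrier R" "s \<in> carrier R"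
  shows "r \<oplus> s \<in> carrier R" "r \<otimes> s \<in> carrier R" "\<ominus> r \<in> carrier R" "r \<ominus> s \<in> carrier R"
proof -
  show "r \<oplus> s \<in> carrier R" "r \<otimes> s \<in> carrier R" "\<ominus> r \<in> carrier R"
    using assms R.add.m_closed[of r s] R.m_closed[of r s] R.add.inv_closed[of r] by auto
  show "r \<ominus> s \<in> carrier R"
    using assms R.add.m_closed[of r "\<ominus>\<^bsub>R\<^esub> s"] R.add.inv_closed[of s] by (auto simp: a_minus_def)
qed

lemma zero_in_R [simp]: "\<zero> \<in> carrier R" and one_in_R [simp]: "\<one> \<in> carrier R"
  using R.zero_closed R.one_closed by auto

lemma R_finsum:
  assumes "finite F" "f \<in> F \<rightarrow> carrier R"
  shows "(\<Oplus>\<^bsub>R\<^esub>i\<in>F. f i) = (\<Oplus>i\<in>F. f i)"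
  using additive_finsum[of R A F "\<lambda>a. a" f] assms R.abelian_group_axioms abelian_group_axioms by simp

end

locale free_extension = ring_extension A R
  for A :: "('k, 'a) module" (structure) and R :: "('k, 'a) module" +
  fixes I :: "'i set" and b :: "'i \<Rightarrow> 'a"
  assumes basis: "left_basis R A I b"
begin

lemma b_closed [simp]: "i \<in> I \<Longrightarrow> b i \<in> carrier A"
  using basis by (auto simp: left_basis_def)

lemma independent:
  assumes "finite F" "F \<subseteq> I" "f \<in> F \<rightarrow> carrier R" "(\<Oplus>i\<in>F. f i \<otimes> b i) = \<zero>" "i \<in> F"
  shows "f i = \<zero>"
  using basis assms unfolding left_basis_def by auto

text \<open>The basis property speaks only of vanishing sums over one finite set. Extending both
  families by zero to \<open>F \<union> G\<close> puts them on a common set, where their difference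
  has sum zero. The conditionals compare coefficients across different supports.\<close>

lemma expansion_unique:
  assumes F: "finite F" "F \<subseteq> I" "f \<in> F \<rightarrow> carrier R"
    and G: "finite G" "G \<subseteq> I" "g \<in> G \<rightarrow> carrier R"
    and eq: "(\<Oplus>i\<in>F. f i \<otimes> b i) = (\<Oplus>i\<in>G. g i \<otimes> b i)"
  shows "(if i \<in> F then f i else \<zero>) = (if i \<in> G then g i else \<zero>)"
proof -
  define f' where "f' = (\<lambda>i. if i \<in> F then f i else \<zero>)"
  define g' where "g' = (\<lambda>i. if i \<in> G then g i else \<zero>)"
  have R' [simp]: "f' j \<in> carrier R" "g' j \<in> carrier R" for j
    using F G by (auto simp: f'_def g'_def Pi_iff)
  have b' [simp]: "b i \<in> carrier A" if "i \<in> F \<union> G" for i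
    using that F G by auto
  have fg [simp]: "i \<in> F \<Longrightarrow> f i \<in> carrier R" "i \<in> G \<Longrightarrow> g i \<in> carrier R" for i
    using F G by auto
  have "(\<Oplus>i\<in>F. f i \<otimes> b i) = (\<Oplus>i\<in>F\<union>G. f' i \<otimes> b i)"
    using F(1) G(1) b' by (intro add.finprod_mono_neutral_cong_left) (auto simp: f'_def)
  moreover have "(\<Oplus>i\<in>G. g i \<otimes> b i) = (\<Oplus>i\<in>F\<union>G. g' i \<otimes> b i)"
    using F(1) G(1) b' by (intro add.finprod_mono_neutral_cong_left) (auto simp: g'_def)
  \<comment> \<open>Writing f' as (f' - g') + g' turns equality of the two sums into cancellation of
    the second one.\<close>
  moreover have "(\<Oplus>i\<in>F\<union>G. f' i \<otimes> b i) = (\<Oplus>i\<in>F\<union>G. (f' i \<ominus> g' i) \<otimes> b i \<oplus> g' i \<otimes> b i)"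
  proof (rule finsum_cong')
    fix i assume "i \<in> F \<union> G"
    then have "b i \<in> carrier A" by (rule b')
    moreover have "f' i \<ominus> g' i \<oplus> g' i = f' i"
      by (simp add: a_minus_def a_assoc l_neg)
    ultimately show "f' i \<otimes> b i = (f' i \<ominus> g' i) \<otimes> b i \<oplus> g' i \<otimes> b i"
      using l_distr[of "f' i \<ominus> g' i" "g' i" "b i"] by simp
  qed (use b' in auto)
  moreover have "\<dots> = (\<Oplus>i\<in>F\<union>G. (f' i \<ominus> g' i) \<otimes> b i) \<oplus> (\<Oplus>i\<in>F\<union>G. g' i \<otimes> b i)"
    using b' by (intro finsum_addf) auto
  moreover have cl: "(\<Oplus>i\<in>F\<union>G. (f' i \<ominus> g' i) \<otimes> b i) \<in> carrier A" "(\<Oplus>i\<in>F\<union>G. g' i \<otimes> b i) \<in> carrier A"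
    using b' by (auto intro!: finsum_closed)
  ultimately have "(\<Oplus>i\<in>F\<union>G. (f' i \<ominus> g' i) \<otimes> b i) \<oplus> (\<Oplus>i\<in>F\<union>G. g' i \<otimes> b i) =
      (\<Oplus>i\<in>F\<union>G. g' i \<otimes> b i)"
    using eq by simp
  then have "(\<Oplus>i\<in>F\<union>G. (f' i \<ominus> g' i) \<otimes> b i) = \<zero>"
    using add.r_cancel_one[OF cl(2,1)] by blast
  then have "i \<in> F \<union> G \<Longrightarrow> f' i \<ominus> g' i = \<zero>"
    using independent[of "F \<union> G" "\<lambda>i. f' i \<ominus> g' i" i] F G R' by auto
  then have "f' i = g' i"
    using R'[of i] by (cases "i \<in> F \<union> G") (auto simp: f'_def g'_def)
  then show ?thesis by (simp add: f'_def g'_def)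
qed

text \<open>The value zero off the chosen support makes the result independent of \<open>F\<close>,
  so coordinates of different elements can be compared at every index.\<close>

definition coef :: "'a \<Rightarrow> 'i \<Rightarrow> 'a" where
  "coef a = (\<lambda>i. THE r. \<exists>F f. finite F \<and> F \<subseteq> I \<and> f \<in> F \<rightarrow> carrier R \<and>
     a = (\<Oplus>i\<in>F. f i \<otimes> b i) \<and> r = (if i \<in> F then f i else \<zero>))"

lemma coef_finsum_basis:
  assumes "finite F" "F \<subseteq> I" "f \<in> F \<rightarrow> carrier R"
  shows "coef (\<Oplus>i\<in>F. f i \<otimes> b i) i = (if i \<in> F then f i else \<zero>)"
  unfolding coef_def
proof (rule the_equality)
  show "\<exists>F' f'. finite F' \<and> F' \<subseteq> I \<and> f' \<in> F' \<rightarrow> carrier R \<and>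
     (\<Oplus>i\<in>F. f i \<otimes> b i) = (\<Oplus>i\<in>F'. f' i \<otimes> b i) \<and>
      (if i \<in> F then f i else \<zero>) = (if i \<in> F' then f' i else \<zero>)"
    using assms by (intro exI[of _ F] exI[of _ f]) auto
next
  fix r
  assume "\<exists>F' f'. finite F' \<and> F' \<subseteq> I \<and> f' \<in> F' \<rightarrow> carrier R \<and>
     (\<Oplus>i\<in>F. f i \<otimes> b i) = (\<Oplus>i\<in>F'. f' i \<otimes> b i) \<and>
      r = (if i \<in> F' then f' i else \<zero>)"
  then obtain F' f' where F': "finite F'" "F' \<subseteq> I" "f' \<in> F' \<rightarrow> carrier R"
     "(\<Oplus>i\<in>F. f i \<otimes> b i) = (\<Oplus>i\<in>F'. f' i \<otimes> b i)" and r: "r = (if i \<in> F' then f' i else \<zero>)"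
    by blast
  show "r = (if i \<in> F then f i else \<zero>)"
    unfolding r by (rule expansion_unique[symmetric]) (use assms F' in auto)
qed

lemma expansionE:
  assumes "a \<in> carrier A"
  obtains F where "finite F" "F \<subseteq> I" "coef a \<in> F \<rightarrow> carrier R" "\<forall>i. i \<notin> F \<longrightarrow> coef a i = \<zero>"
    "a = (\<Oplus>i\<in>F. coef a i \<otimes> b i)"
proof -
  obtain F f where F: "finite F" "F \<subseteq> I" "f \<in> F \<rightarrow> carrier R" "a = (\<Oplus>i\<in>F. f i \<otimes> b i)"
    using basis assms unfolding left_basis_def by blast
  have c: "coef a i = (if i \<in> F then f i else \<zero>)" for i
    using coef_finsum_basis[OF F(1-3)] F(4) by simp
  have "a = (\<Oplus>i\<in>F. coef a i \<otimes> b i)"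
    proof -
    have "f i \<otimes> b i \<in> carrier A" if "i \<in> F" for i
    proof -
      have "f i \<in> carrier R" "i \<in> I" using that F by auto
      then show ?thesis by simp
    qed
    then show ?thesis
      using F(4) c by (auto intro!: finsum_cong')
  qed
  moreover have "coef a \<in> F \<rightarrow> carrier R" using F(3) c by auto
  ultimately show thesis using that[of F] F(1,2) c by simp
qed

lemma coef_closed [simp]: "a \<in> carrier A \<Longrightarrow> coef a i \<in> carrier R"
proof -
  assume "a \<in> carrier A"
  then obtain F where "finite F" "F \<subseteq> I" and F: "coef a \<in> F \<rightarrow> carrier R" "\<forall>i. i \<notin> F \<longrightarrow> coef a i = \<zero>"
    and "a = (\<Oplus>i\<in>F. coef a i \<otimes> b i)" by (rule expansionE)
  show ?thesis using F zero_in_R by (cases "i \<in> F") auto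
qed

lemma coef_basis_term:
  assumes "r \<in> carrier R" "i \<in> I"
  shows "coef (r \<otimes> b i) j = (if j = i then r else \<zero>)"
  using coef_finsum_basis[of "{i}" "\<lambda>_. r" j] assms by simp

lemma coef_zero [simp]: "coef \<zero> i = \<zero>"
  using coef_finsum_basis[of "{}" "\<lambda>_. \<zero>" i] by simp

lemma coef_add:
  assumes "a \<in> carrier A" "a' \<in> carrier A"
  shows "coef (a \<oplus> a') i = coef a i \<oplus> coef a' i"
proof -
  obtain F where F: "finite F" "F \<subseteq> I" "coef a \<in> F \<rightarrow> carrier R" "\<forall>i. i \<notin> F \<longrightarrow> coef a i = \<zero>"
    "a = (\<Oplus>i\<in>F. coef a i \<otimes> b i)" by (rule expansionE[OF assms(1)])
  obtain G where G: "finite G" "G \<subseteq> I" "coef a' \<in> G \<rightarrow> carrier R" "\<forall>i. i \<notin> G \<longrightarrow> coef a' i = \<zero>"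
    "a' = (\<Oplus>i\<in>G. coef a' i \<otimes> b i)" by (rule expansionE[OF assms(2)])
  have b' [simp]: "b i \<in> carrier A" if "i \<in> F \<union> G" for i
    using that F(2) G(2) by auto
  have "a = (\<Oplus>i\<in>F\<union>G. coef a i \<otimes> b i)"
    by (subst F(5), intro add.finprod_mono_neutral_cong_left)
      (use F(1,4) G(1,4) assms b' in auto)
  moreover have "a' = (\<Oplus>i\<in>F\<union>G. coef a' i \<otimes> b i)"
    by (subst G(5), intro add.finprod_mono_neutral_cong_left)
      (use F(1,4) G(1,4) assms b' in auto)
  moreover have "(\<Oplus>i\<in>F\<union>G. coef a i \<otimes> b i) \<oplus> (\<Oplus>i\<in>F\<union>G. coef a' i \<otimes> b i) =
      (\<Oplus>i\<in>F\<union>G. coef a i \<otimes> b i \<oplus> coef a' i \<otimes> b i)"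
    by (rule finsum_addf[symmetric]) (use F(1,4) G(1,4) assms b' in auto)
  moreover have "\<dots> = (\<Oplus>i\<in>F\<union>G. (coef a i \<oplus> coef a' i) \<otimes> b i)"
    by (rule finsum_cong') (use assms b' in \<open>auto simp: l_distr\<close>)
  ultimately have "coef (a \<oplus> a') i = coef (\<Oplus>i\<in>F\<union>G. (coef a i \<oplus> coef a' i) \<otimes> b i) i"
    by metis
  also have "\<dots> = coef a i \<oplus> coef a' i"
    using coef_finsum_basis[of "F \<union> G" "\<lambda>i. coef a i \<oplus> coef a' i" i] F(1-4) G(1-4) assms by auto
  finally show ?thesis .
qed

lemma coef_finsum:
  assumes "finite F" "f \<in> F \<rightarrow> carrier A"
  shows "coef (\<Oplus>j\<in>F. f j) i = (\<Oplus>j\<in>F. coef (f j) i)"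
  using additive_finsum[of A A F "\<lambda>a. coef a i" f] assms abelian_group_axioms
  by (simp add: coef_add)

lemma coef_eqI:
  assumes "a \<in> carrier A" "a' \<in> carrier A" "\<And>i. i \<in> I \<Longrightarrow> coef a i = coef a' i"
  shows "a = a'"
proof -
  obtain F where F: "finite F" "F \<subseteq> I" "coef a \<in> F \<rightarrow> carrier R" "\<forall>i. i \<notin> F \<longrightarrow> coef a i = \<zero>"
    "a = (\<Oplus>i\<in>F. coef a i \<otimes> b i)" by (rule expansionE[OF assms(1)])
  obtain G where G: "finite G" "G \<subseteq> I" "coef a' \<in> G \<rightarrow> carrier R" "\<forall>i. i \<notin> G \<longrightarrow> coef a' i = \<zero>"
    "a' = (\<Oplus>i\<in>G. coef a' i \<otimes> b i)" by (rule expansionE[OF assms(2)])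
  have b' [simp]: "b i \<in> carrier A" if "i \<in> F \<union> G" for i
    using that F(2) G(2) by auto
  have "a = (\<Oplus>i\<in>F\<union>G. coef a i \<otimes> b i)"
    by (subst F(5), intro add.finprod_mono_neutral_cong_left)
      (use F(1,4) G(1,4) assms b' in auto)
  also have "\<dots> = (\<Oplus>i\<in>F\<union>G. coef a' i \<otimes> b i)"
    by (rule finsum_cong') (use F(2) G(2) assms b' in auto)
  also have "\<dots> = a'"
    by (subst (2) G(5), intro add.finprod_mono_neutral_cong_right)
      (use F(1,4) G(1,4) assms b' in auto)
  finally show ?thesis .
qed

text \<open>Only terms with a nonzero coefficient of the given \<open>a\<close> arise in the last
  case. This lets restrictions on the support of \<open>a\<close> pass to its terms.\<close>

lemma expansion_induct [consumes 1, case_names zero add summand]: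
  assumes "a \<in> carrier A" "P \<zero>"
    "\<And>a a'. \<lbrakk>a \<in> carrier A; a' \<in> carrier A; P a; P a'\<rbrakk> \<Longrightarrow> P (a \<oplus> a')"
    "\<And>i. \<lbrakk>i \<in> I; coef a i \<noteq> \<zero>\<rbrakk> \<Longrightarrow> P (coef a i \<otimes> b i)"
  shows "P a"
proof -
  obtain F where F: "finite F" "F \<subseteq> I" "coef a \<in> F \<rightarrow> carrier R"
    "a = (\<Oplus>i\<in>F. coef a i \<otimes> b i)" by (rule expansionE[OF assms(1)])
  have term': "P (coef a i \<otimes> b i)" if "i \<in> F" for i
    using assms(2) assms(4)[of i] that F(2) by (cases "coef a i = \<zero>") auto
  have "(\<Oplus>i\<in>F. coef a i \<otimes> b i) \<in> {c \<in> carrier A. P c}"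
    by (rule finsum_closed_under) (use F(1,2) assms term' in auto)
  then show ?thesis unfolding F(4)[symmetric] by simp
qed

end

section \<open>Graded algebras\<close>

lemma (in abelian_group) finsum_pad:
  assumes "f \<in> {..d} \<rightarrow> carrier G" "d \<le> (e :: nat)"
  shows "(\<Oplus>m\<in>{..d}. f m) = (\<Oplus>m\<in>{..e}. if m \<le> d then f m else \<zero>)"
  using assms by (intro add.finprod_mono_neutral_cong_left) auto

context graded_algebra
begin

lemma gr_carrier: "a \<in> gr m \<Longrightarrow> a \<in> carrier A"
  using M.submoduleE(1)[OF subspace] by auto

lemma gr_zero: "\<zero>\<^bsub>A\<^esub> \<in> gr m"
  using subgroup.one_closed[OF submodule.axioms(1)[OF subspace[of m]]] by simp

lemma gr_add: "a \<in> gr m \<Longrightarrow> b \<in> gr m \<Longrightarrow> a \<oplus>\<^bsub>A\<^esub> b \<in> gr m"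
  using M.submoduleE(5)[OF subspace] by auto

lemma gr_a_inv: "a \<in> gr m \<Longrightarrow> \<ominus>\<^bsub>A\<^esub> a \<in> gr m"
  using M.submoduleE(3)[OF subspace] by auto

lemma gr_smult: "k \<in> carrier K \<Longrightarrow> a \<in> gr m \<Longrightarrow> k \<odot>\<^bsub>A\<^esub> a \<in> gr m"
  using M.submoduleE(4)[OF subspace] by auto

text \<open>The lower bound \<open>e\<close> ensures that the decomposition has a slot for a
  prescribed degree, padded by zero if necessary.\<close>

lemma sum_componentsE:
  assumes "a \<in> carrier A"
  obtains d f where "e \<le> d" "f \<in> (\<Pi> m\<in>{..d}. gr m)" "a = (\<Oplus>\<^bsub>A\<^esub>m\<in>{..d}. f m)"
proof -
  obtain d f where f: "f \<in> (\<Pi> m\<in>{..d}. gr m)" "a = (\<Oplus>\<^bsub>A\<^esub>m\<in>{..d}. f m)"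
    using sum_components[OF assms] by blast
  show thesis
  proof (rule that[of "max d e" "\<lambda>m. if m \<le> d then f m else \<zero>\<^bsub>A\<^esub>"])
    show "a = (\<Oplus>\<^bsub>A\<^esub>m\<in>{..max d e}. if m \<le> d then f m else \<zero>\<^bsub>A\<^esub>)"
      unfolding f(2) by (rule M.M.finsum_pad) (use f gr_carrier in auto)
  qed (use f gr_zero in auto)
qed

text \<open>Subtract \<open>a\<close> from the summand of degree \<open>p\<close>: the resulting
  homogeneous family sums to zero, so its component \<open>f p - a\<close> vanishes.\<close>

lemma homogeneous_component:
  assumes "a \<in> gr p" "f \<in> (\<Pi> m\<in>{..d}. gr m)" "a = (\<Oplus>\<^bsub>A\<^esub>m\<in>{..d}. f m)" "p \<le> d"
  shows "f p = a"
proof -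
  have cl: "f m \<in> carrier A" if "m \<le> d" for m
    using that assms(2) gr_carrier by auto
  have a: "a \<in> carrier A" using assms(1) gr_carrier by auto
  define u where "u = (\<lambda>m. if m = p then \<ominus>\<^bsub>A\<^esub> a else \<zero>\<^bsub>A\<^esub>)"
  have "(\<Oplus>\<^bsub>A\<^esub>m\<in>{..d}. f m \<oplus>\<^bsub>A\<^esub> u m) = (\<Oplus>\<^bsub>A\<^esub>m\<in>{..d}. f m) \<oplus>\<^bsub>A\<^esub> (\<Oplus>\<^bsub>A\<^esub>m\<in>{..d}. u m)"
    using a cl by (intro M.M.finsum_addf) (auto simp: u_def)
  moreover have "(\<Oplus>\<^bsub>A\<^esub>m\<in>{..d}. u m) = \<ominus>\<^bsub>A\<^esub> a"
    unfolding u_def using M.M.add.finprod_singleton_swap[of p "{..d}" "\<lambda>_. \<ominus>\<^bsub>A\<^esub> a"] a assms(4) by simp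
  ultimately have "(\<Oplus>\<^bsub>A\<^esub>m\<in>{..d}. f m \<oplus>\<^bsub>A\<^esub> u m) = \<zero>\<^bsub>A\<^esub>"
    using assms(3) a by (simp add: M.M.r_neg)
  then have "f p \<oplus>\<^bsub>A\<^esub> u p = \<zero>\<^bsub>A\<^esub>"
    using assms by (intro independent_components[of "\<lambda>m. f m \<oplus>\<^bsub>A\<^esub> u m" d p])
      (auto simp: u_def intro!: gr_add gr_a_inv gr_zero)
  then have "f p \<oplus>\<^bsub>A\<^esub> \<ominus>\<^bsub>A\<^esub> a = \<zero>\<^bsub>A\<^esub>" by (simp add: u_def)
  then show ?thesis
    using M.M.minus_equality[of "f p" "\<ominus>\<^bsub>A\<^esub> a"] a cl[OF assms(4)] by simp
qed

lemma homogeneous_induct [consumes 1, case_names add homogeneous]: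
  assumes "a \<in> carrier A"
    "\<And>a b. \<lbrakk>a \<in> carrier A; b \<in> carrier A; P a; P b\<rbrakk> \<Longrightarrow> P (a \<oplus>\<^bsub>A\<^esub> b)"
    "\<And>a m. a \<in> gr m \<Longrightarrow> P a"
  shows "P a"
proof -
  obtain d f where f: "f \<in> (\<Pi> m\<in>{..d}. gr m)" "a = (\<Oplus>\<^bsub>A\<^esub>m\<in>{..d}. f m)"
    using sum_components[OF assms(1)] by blast
  have "f m \<in> carrier A \<and> P (f m)" if "m \<le> d" for m
    using that f(1) gr_carrier[of "f m" m] assms(3)[of "f m" m] by auto
  then have "(\<Oplus>\<^bsub>A\<^esub>m\<in>{..d}. f m) \<in> {a \<in> carrier A. P a}"
    using assms(2) assms(3)[OF gr_zero] by (intro M.M.finsum_closed_under) auto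
  then show ?thesis using f by simp
qed

text \<open>Let \<open>e 0\<close> be the degree-0 component of 1. Comparing components of degree
  \<open>p\<close> in \<open>a = a 1\<close>, for \<open>a\<close> of degree \<open>p\<close>, shows
  that \<open>e 0\<close> is a right identity on homogeneous elements, hence everywhere; applied to
  1 this gives \<open>1 = e 0\<close>.\<close>

lemma one_degree: "\<one>\<^bsub>A\<^esub> \<in> gr 0"
proof -
  obtain d e where e: "e \<in> (\<Pi> m\<in>{..d}. gr m)" "\<one>\<^bsub>A\<^esub> = (\<Oplus>\<^bsub>A\<^esub>m\<in>{..d}. e m)"
    using sum_components[OF A.one_closed] by blast
  have e0: "e 0 \<in> gr 0" "e 0 \<in> carrier A" using e(1) gr_carrier by auto
  have hom: "a \<otimes>\<^bsub>A\<^esub> e 0 = a" if a: "a \<in> gr p" for a p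
  proof -
    \<comment> \<open>The decomposition of \<open>a = a 1\<close> with the index shifted by
      \<open>p\<close>: degree \<open>m\<close> carries \<open>a e(m - p)\<close>, and degrees below
      \<open>p\<close> are empty.\<close>
    define f where "f = (\<lambda>m. if p \<le> m then a \<otimes>\<^bsub>A\<^esub> e (m - p) else \<zero>\<^bsub>A\<^esub>)"
    have aA: "a \<in> carrier A" using a gr_carrier by auto
    have ecl: "e \<in> {..d} \<rightarrow> carrier A" using e(1) gr_carrier by auto
    have fgr: "f \<in> (\<Pi> m\<in>{..d + p}. gr m)"
    proof
      fix m assume m: "m \<in> {..d + p}"
      show "f m \<in> gr m"
      proof (cases "p \<le> m")
        case True
        then have "e (m - p) \<in> gr (m - p)" using m e(1) by auto
        then show ?thesis using mult_degree[OF a, of "e (m - p)" "m - p"] True by (simp add: f_def)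
      qed (simp add: f_def gr_zero)
    qed
    have fcl: "f m \<in> carrier A" if "m \<le> d + p" for m
      using that fgr gr_carrier[of "f m" m] by auto
    have "a = (\<Oplus>\<^bsub>A\<^esub>m\<in>{..d}. a \<otimes>\<^bsub>A\<^esub> e m)"
      using A.finsum_rdistr[OF _ aA ecl] A.r_one[OF aA] e(2) by simp
    also have "\<dots> = (\<Oplus>\<^bsub>A\<^esub>m\<in>{..d}. f (m + p))"
      unfolding f_def using aA ecl by (intro M.M.finsum_cong') auto
    also have "\<dots> = (\<Oplus>\<^bsub>A\<^esub>m\<in>(\<lambda>m. m + p) ` {..d}. f m)"
      using fcl by (intro M.M.finsum_reindex[symmetric]) auto
    also have "\<dots> = (\<Oplus>\<^bsub>A\<^esub>m\<in>{..d + p}. f m)"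
    proof (rule M.M.add.finprod_mono_neutral_cong_left)
      fix i assume "i \<in> {..d + p} - (\<lambda>m. m + p) ` {..d}"
      then have "\<not> p \<le> i"
        by (metis DiffD1 DiffD2 atMost_iff imageI le_add_diff_inverse2 add_le_cancel_right)
      then show "f i = \<zero>\<^bsub>A\<^esub>" by (simp add: f_def)
    qed (use fcl in auto)
    finally show ?thesis
      using homogeneous_component[OF a fgr] by (simp add: f_def)
  qed
  have "a \<otimes>\<^bsub>A\<^esub> e 0 = a" if "a \<in> carrier A" for a
    using that by (induction rule: homogeneous_induct) (simp_all add: A.l_distr e0 hom)
  then have "\<one>\<^bsub>A\<^esub> = e 0" using e0 by (metis A.one_closed A.l_one)
  then show ?thesis using e0 by simp
qed

text \<open>The preimage of a homogeneous element is a priori inhomogeneous. But \<open>h\<close>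
  sends its components to the components of the image, so the component of degree \<open>p\<close>
  alone is already a preimage.\<close>

lemma additive_bij_image_gr:
  assumes h: "bij_betw h (carrier A) (carrier A)"
    and add: "\<And>a b. a \<in> carrier A \<Longrightarrow> b \<in> carrier A \<Longrightarrow> h (a \<oplus>\<^bsub>A\<^esub> b) = h a \<oplus>\<^bsub>A\<^esub> h b"
    and deg: "\<And>m. h ` gr m \<subseteq> gr m"
  shows "h ` gr p = gr p"
proof
  have cl: "h a \<in> carrier A" if "a \<in> carrier A" for a
    using that h by (auto simp: bij_betw_def)
  have zero: "h \<zero>\<^bsub>A\<^esub> = \<zero>\<^bsub>A\<^esub>"
    using add[of "\<zero>\<^bsub>A\<^esub>" "\<zero>\<^bsub>A\<^esub>"] cl[of "\<zero>\<^bsub>A\<^esub>"] M.M.add.r_cancel_one[of "h \<zero>\<^bsub>A\<^esub>" "h \<zero>\<^bsub>A\<^esub>"] by simp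
  show "gr p \<subseteq> h ` gr p"
  proof
    fix b assume b: "b \<in> gr p"
    then obtain a where a: "a \<in> carrier A" "b = h a"
      using h gr_carrier[OF b] unfolding bij_betw_def by blast
    obtain d f where f: "p \<le> d" "f \<in> (\<Pi> m\<in>{..d}. gr m)" "a = (\<Oplus>\<^bsub>A\<^esub>m\<in>{..d}. f m)"
      by (rule sum_componentsE[OF a(1)])
    have "b = (\<Oplus>\<^bsub>A\<^esub>m\<in>{..d}. h (f m))"
      unfolding a(2) f(3) using f(2) gr_carrier cl zero add M.M.abelian_group_axioms
      by (intro additive_finsum) auto
    moreover have "(\<lambda>m. h (f m)) \<in> (\<Pi> m\<in>{..d}. gr m)"
      using f(2) deg by auto
    ultimately have "h (f p) = b"
      using homogeneous_component[OF b] f(1) by blast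
    then show "b \<in> h ` gr p" using f(1,2) by auto
  qed
qed (rule deg)

end

section \<open>Standard monomials\<close>

locale PBW_basis = free_extension A R "exponents n" "std_mono A x n"
  for A :: "('k, 'a) module" (structure) and R :: "('k, 'a) module" and n :: nat and x :: "nat \<Rightarrow> 'a" +
  assumes x_funcset: "x \<in> {1..n} \<rightarrow> carrier A"
begin

lemma x_closed [simp]: "1 \<le> i \<Longrightarrow> i \<le> n \<Longrightarrow> x i \<in> carrier A"
  using x_funcset by auto

lemma std_mono_closed [simp]: "k \<le> n \<Longrightarrow> std_mono A x k \<alpha> \<in> carrier A"
  by (induction k) auto

lemma std_mono_cong:
  "(\<And>i. 1 \<le> i \<Longrightarrow> i \<le> k \<Longrightarrow> \<alpha> i = \<beta> i) \<Longrightarrow> std_mono A x k \<alpha> = std_mono A x k \<beta>"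
  by (induction k) auto

lemma std_mono_truncate:
  assumes "k \<le> j" "j \<le> n" "\<And>i. k < i \<Longrightarrow> i \<le> j \<Longrightarrow> \<alpha> i = 0"
  shows "std_mono A x j \<alpha> = std_mono A x k \<alpha>"
  using assms by (induction j rule: dec_induct) auto

text \<open>Exponents using only the first \<open>k\<close> variables, still as functions on all of
  \<open>{1..n}\<close>: every stage then shares one index set and one function
  \<open>coef\<close>.\<close>

definition exps :: "nat \<Rightarrow> (nat \<Rightarrow> nat) set" where
  "exps k = {\<alpha> \<in> exponents n. \<forall>i. k < i \<and> i \<le> n \<longrightarrow> \<alpha> i = 0}"

abbreviation monomial :: "(nat \<Rightarrow> nat) \<Rightarrow> 'a" where
  "monomial \<equiv> std_mono A x n"

definition unit_exp :: "nat \<Rightarrow> nat \<Rightarrow> nat" where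
  "unit_exp i = (\<lambda>j\<in>{1..n}. if j = i then 1 else 0)"

definition zero_exp :: "nat \<Rightarrow> nat" where
  "zero_exp = (\<lambda>j\<in>{1..n}. 0)"

lemma exps_exponents: "\<alpha> \<in> exps k \<Longrightarrow> \<alpha> \<in> exponents n"
  by (simp add: exps_def)

lemma exps_mono: "k \<le> l \<Longrightarrow> exps k \<subseteq> exps l"
  by (auto simp: exps_def)

lemma exps_n: "exps n = exponents n"
  by (auto simp: exps_def)

lemma zero_exp_in: "zero_exp \<in> exps k"
  by (auto simp: exps_def exponents_def zero_exp_def)

lemma exps_0: "exps 0 = {zero_exp}"
proof
  show "exps 0 \<subseteq> {zero_exp}"
  proof
    fix \<alpha> assume "\<alpha> \<in> exps 0"
    then have "\<alpha> i = zero_exp i" for i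
      by (cases "i \<in> {1..n}") (auto simp: exps_def exponents_def zero_exp_def PiE_def extensional_def)
    then show "\<alpha> \<in> {zero_exp}" by auto
  qed
qed (simp add: zero_exp_in)

lemma exps_upd:
  assumes "\<alpha> \<in> exps l" "1 \<le> j" "j \<le> k" "l \<le> k" "k \<le> n"
  shows "\<alpha>(j := q) \<in> exps k"
  using assms by (auto simp: exps_def exponents_def PiE_def extensional_def)

lemma exps_del:
  assumes "\<alpha> \<in> exps (Suc k)" "k < n"
  shows "\<alpha>(Suc k := 0) \<in> exps k"
  using assms by (auto simp: exps_def exponents_def PiE_def extensional_def)

lemma unit_exp_in: "1 \<le> i \<Longrightarrow> i \<le> k \<Longrightarrow> unit_exp i \<in> exps k"
  by (auto simp: exps_def exponents_def unit_exp_def)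

lemma mono_eq_std_mono: "\<alpha> \<in> exps k \<Longrightarrow> k \<le> n \<Longrightarrow> monomial \<alpha> = std_mono A x k \<alpha>"
  by (intro std_mono_truncate) (auto simp: exps_def)

lemma mono_closed [simp]: "monomial \<alpha> \<in> carrier A"
  by simp

text \<open>The variable \<open>x (Suc k)\<close> stands to the right of all variables occurring in
  \<alpha>, so its power is appended without any reordering.\<close>

lemma mono_upd:
  assumes "\<alpha> \<in> exps k" "k < n"
  shows "monomial (\<alpha>(Suc k := q)) = monomial \<alpha> \<otimes> x (Suc k) [^] q"
proof -
  have "monomial (\<alpha>(Suc k := q)) = std_mono A x (Suc k) (\<alpha>(Suc k := q))"
    using assms exps_upd[of \<alpha> k "Suc k" "Suc k"] by (intro mono_eq_std_mono) auto
  also have "\<dots> = std_mono A x k \<alpha> \<otimes> x (Suc k) [^] q"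
    using std_mono_cong[of k "\<alpha>(Suc k := q)" \<alpha>] by simp
  finally show ?thesis using mono_eq_std_mono[OF assms(1)] assms(2) by simp
qed

lemma mono_zero_exp [simp]: "monomial zero_exp = \<one>"
  using mono_eq_std_mono[OF zero_exp_in[of 0]] by simp

lemma mono_unit_exp:
  assumes "1 \<le> i" "i \<le> n"
  shows "monomial (unit_exp i) = x i"
proof -
  obtain k where k: "i = Suc k" using assms(1) by (cases i) auto
  have "unit_exp i = zero_exp(Suc k := 1)"
    using assms k by (auto simp: unit_exp_def zero_exp_def fun_eq_iff)
  then show ?thesis using mono_upd[OF zero_exp_in, of k 1] assms k by simp
qed

lemma mono_product:
  assumes "1 \<le> i" "i < j" "j \<le> n"
  shows "monomial ((unit_exp i)(j := 1)) = x i \<otimes> x j"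
proof -
  obtain k where k: "j = Suc k" using assms by (cases j) auto
  show ?thesis
    using mono_upd[OF unit_exp_in[of i k], of 1] mono_unit_exp assms k by simp
qed

lemma coef_mono:
  "\<lbrakk>r \<in> carrier R; \<alpha> \<in> exps k\<rbrakk> \<Longrightarrow> coef (r \<otimes> monomial \<alpha>) \<beta> = (if \<beta> = \<alpha> then r else \<zero>)"
  by (rule coef_basis_term) (auto simp: exps_exponents)

lemma coef_R: "r \<in> carrier R \<Longrightarrow> coef r \<beta> = (if \<beta> = zero_exp then r else \<zero>)"
  using coef_mono[OF _ zero_exp_in[of 0], of r \<beta>] by simp

lemma coef_x: "\<lbrakk>r \<in> carrier R; 1 \<le> i; i \<le> n\<rbrakk> \<Longrightarrow>
    coef (r \<otimes> x i) \<beta> = (if \<beta> = unit_exp i then r else \<zero>)"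
  using coef_mono[OF _ unit_exp_in[of i n], of r \<beta>] mono_unit_exp[of i] by simp

lemma unit_exp_neq_zero: "1 \<le> i \<Longrightarrow> i \<le> n \<Longrightarrow> zero_exp \<noteq> unit_exp i"
  by (auto simp: unit_exp_def zero_exp_def fun_eq_iff)

text \<open>Compare coefficients at the monomial 1. This kills \<delta> once quasi-commutativity
  writes \<open>x i r\<close> as a left multiple of \<open>x i\<close>.\<close>

lemma derivation_zeroI:
  assumes i: "1 \<le> i" "i \<le> n" and R: "s \<in> carrier R" "d \<in> carrier R" "s' \<in> carrier R"
    and eq: "s \<otimes> x i \<oplus> d = s' \<otimes> x i"
  shows "d = \<zero>"
proof -
  have "coef (s \<otimes> x i \<oplus> d) zero_exp = d"
    using i R unit_exp_neq_zero[OF i] by (simp add: coef_add coef_x coef_R)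
  moreover have "coef (s' \<otimes> x i) zero_exp = \<zero>"
    using i R unit_exp_neq_zero[OF i] by (simp add: coef_x)
  ultimately show ?thesis using eq by simp
qed

text \<open>Compare coefficients at \<open>x i x j\<close>, a standard monomial because i < j and
  one absent from the affine part. It identifies the constant supplied by quasi-commutativity with
  the one known to be a unit of degree 0.\<close>

lemma structure_constant_unique:
  assumes ij: "1 \<le> i" "i < j" "j \<le> n" and R: "c \<in> carrier R" "c' \<in> carrier R"
    and aff: "y \<ominus> c \<otimes> (x i \<otimes> x j) \<in> affine_part A n x (carrier R) (carrier R)"
    and y: "y = c' \<otimes> (x i \<otimes> x j)"
  shows "c' = c"
proof -
  define \<gamma> where "\<gamma> = (unit_exp i)(j := 1)"
  have \<gamma>: "\<gamma> \<in> exps n" "monomial \<gamma> = x i \<otimes> x j"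
    unfolding \<gamma>_def using ij unit_exp_in[of i n] exps_upd[of "unit_exp i" n j n] mono_product by auto
  \<comment> \<open>\<gamma> takes the value 1 at both i and j, while a unit vector vanishes at one
    of them.\<close>
  have ne: "\<gamma> \<noteq> unit_exp l" "\<gamma> \<noteq> zero_exp" for l
  proof -
    have "\<gamma> i = 1" "\<gamma> j = 1" using ij by (auto simp: \<gamma>_def unit_exp_def)
    moreover have "zero_exp i = 0" "l \<noteq> i \<Longrightarrow> unit_exp l i = 0" "l \<noteq> j \<Longrightarrow> unit_exp l j = 0"
      using ij by (auto simp: zero_exp_def unit_exp_def)
    ultimately show "\<gamma> \<noteq> unit_exp l" "\<gamma> \<noteq> zero_exp" using ij by fastforce+
  qed
  obtain s t where st: "s \<in> carrier R" "t \<in> {1..n} \<rightarrow> carrier R"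
    and eq: "y \<ominus> c \<otimes> (x i \<otimes> x j) = s \<oplus> (\<Oplus>l\<in>{1..n}. t l \<otimes> x l)"
    using aff unfolding affine_part_def by blast
  have "coef (\<Oplus>l\<in>{1..n}. t l \<otimes> x l) \<gamma> = (\<Oplus>l\<in>{1..n}. coef (t l \<otimes> x l) \<gamma>)"
    using st by (intro coef_finsum) (auto simp: Pi_iff)
  also have "\<dots> = (\<Oplus>l\<in>{1..n}. \<zero>)"
    using st ne by (intro finsum_cong') (auto simp: Pi_iff coef_x)
  finally have "coef (s \<oplus> (\<Oplus>l\<in>{1..n}. t l \<otimes> x l)) \<gamma> = \<zero>"
    using st ne by (subst coef_add) (auto simp: Pi_iff coef_R intro!: finsum_closed)
  moreover have "y \<ominus> c \<otimes> (x i \<otimes> x j) = (c' \<ominus> c) \<otimes> monomial \<gamma>"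
    using R ij y \<gamma>(2) by (simp add: a_minus_def l_distr l_minus)
  ultimately have "c' \<ominus> c = \<zero>"
    using eq coef_mono[OF _ \<gamma>(1), of "c' \<ominus> c" \<gamma>] R by simp
  then show ?thesis using R by simp
qed

end

section \<open>The graded pieces of the subalgebras generated by initial variables\<close>

text \<open>The hypotheses in working form: derivations and affine remainders are gone, and the
  relations hold with the very \<sigma> and \<open>c\<close> that are graded and invertible.\<close>

locale graded_quasi_commutative = PBW_basis A R n x
  for K :: "('k, 'l) ring_scheme" and A :: "('k, 'a) module" (structure)
    and R :: "('k, 'a) module" and n :: nat and x :: "nat \<Rightarrow> 'a" +
  fixes gr :: "nat \<Rightarrow> 'a set" and \<sigma> :: "nat \<Rightarrow> 'a \<Rightarrow> 'a" and c :: "nat \<Rightarrow> nat \<Rightarrow> 'a"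
  assumes graded_R: "graded_algebra K R gr"
    and alg_A: "k_algebra K A"
    and incl_alg_hom: "(\<lambda>a. a) \<in> alg_hom K R A"
    and \<sigma>_hom: "\<lbrakk>1 \<le> i; i \<le> n\<rbrakk> \<Longrightarrow> \<sigma> i \<in> ring_hom R R"
    and \<sigma>_bij: "\<lbrakk>1 \<le> i; i \<le> n\<rbrakk> \<Longrightarrow> bij_betw (\<sigma> i) (carrier R) (carrier R)"
    and \<sigma>_gr: "\<lbrakk>1 \<le> i; i \<le> n; r \<in> gr m\<rbrakk> \<Longrightarrow> \<sigma> i r \<in> gr m"
    and x_R: "\<lbrakk>1 \<le> i; i \<le> n; r \<in> carrier R\<rbrakk> \<Longrightarrow> x i \<otimes> r = \<sigma> i r \<otimes> x i"
    and c_unit: "\<lbrakk>1 \<le> i; i < j; j \<le> n\<rbrakk> \<Longrightarrow> c i j \<in> Units R \<inter> gr 0"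
    and x_x: "\<lbrakk>1 \<le> i; i < j; j \<le> n\<rbrakk> \<Longrightarrow> x j \<otimes> x i = c i j \<otimes> (x i \<otimes> x j)"
begin

interpretation GR: graded_algebra K R gr by (rule graded_R)
interpretation AA: k_algebra K A by (rule alg_A)

section \<open>Operations of \<open>R\<close> inside \<open>A\<close>, and reordering up to units of
  degree 0\<close>

lemma \<sigma>_facts:
  assumes "1 \<le> i" "i \<le> n"
  shows "r \<in> carrier R \<Longrightarrow> \<sigma> i r \<in> carrier R"
    and "\<lbrakk>r \<in> carrier R; s \<in> carrier R\<rbrakk> \<Longrightarrow> \<sigma> i (r \<oplus> s) = \<sigma> i r \<oplus> \<sigma> i s"
    and "\<lbrakk>r \<in> carrier R; s \<in> carrier R\<rbrakk> \<Longrightarrow> \<sigma> i (r \<otimes> s) = \<sigma> i r \<otimes> \<sigma> i s"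
    and "\<sigma> i \<one> = \<one>"
  using \<sigma>_hom[OF assms] R_ops ring_hom_closed[of "\<sigma> i" R R]
    ring_hom_add[of "\<sigma> i" R R] ring_hom_mult[of "\<sigma> i" R R] ring_hom_one[of "\<sigma> i" R R]
  by (metis R_one)+

lemma gr_R [simp]: "a \<in> gr m \<Longrightarrow> a \<in> carrier R"
  by (rule GR.gr_carrier)

lemma gr_ops:
  shows "\<zero> \<in> gr m"
    and "\<one> \<in> gr 0"
    and "a \<in> gr m \<Longrightarrow> a' \<in> gr m \<Longrightarrow> a \<oplus> a' \<in> gr m"
    and "a \<in> gr m \<Longrightarrow> \<ominus> a \<in> gr m"
    and "a \<in> gr p \<Longrightarrow> a' \<in> gr q \<Longrightarrow> a \<otimes> a' \<in> gr (p + q)"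
    and "k \<in> carrier K \<Longrightarrow> a \<in> gr m \<Longrightarrow> k \<odot> a \<in> gr m"
proof -
  show "\<zero> \<in> gr m" "\<one> \<in> gr 0" using GR.gr_zero[of m] GR.one_degree by simp_all
  show "a \<in> gr m \<Longrightarrow> a' \<in> gr m \<Longrightarrow> a \<oplus> a' \<in> gr m" using GR.gr_add[of a m a'] by simp
  show "a \<in> gr m \<Longrightarrow> \<ominus> a \<in> gr m" using GR.gr_a_inv[of a m] by simp
  show "a \<in> gr p \<Longrightarrow> a' \<in> gr q \<Longrightarrow> a \<otimes> a' \<in> gr (p + q)" using GR.mult_degree[of a p a' q] by simp
  show "k \<in> carrier K \<Longrightarrow> a \<in> gr m \<Longrightarrow> k \<odot> a \<in> gr m"
    using GR.gr_smult[of k a m] incl_alg_hom by (auto simp: alg_hom_def)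
qed

text \<open>The factors created by reordering. Both inverse laws matter: \<open>v u = 1\<close>
  gives surjectivity of the twisting map, \<open>u v = 1\<close> its injectivity.\<close>

definition gr_units :: "'a set" where
  "gr_units = {u \<in> gr 0. \<exists>v\<in>carrier R. v \<otimes> u = \<one> \<and> u \<otimes> v = \<one>}"

lemma gr_units_gr: "u \<in> gr_units \<Longrightarrow> u \<in> gr 0"
  by (simp add: gr_units_def)

lemma gr_units_R [simp]: "u \<in> gr_units \<Longrightarrow> u \<in> carrier R"
  using gr_units_gr gr_R by blast

lemma gr_units_inverse:
  assumes "u \<in> gr_units"
  obtains v where "v \<in> carrier R" "v \<otimes> u = \<one>" "u \<otimes> v = \<one>"
  using assms unfolding gr_units_def by blast

lemma one_gr_units: "\<one> \<in> gr_units"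
  unfolding gr_units_def using gr_ops(2) one_in_R l_one[OF one_closed] by blast

lemma mult_gr_units:
  assumes "u \<in> gr_units" "v \<in> gr_units"
  shows "u \<otimes> v \<in> gr_units"
proof -
  obtain u' where u': "u' \<in> carrier R" "u' \<otimes> u = \<one>" "u \<otimes> u' = \<one>"
    using assms(1) by (rule gr_units_inverse)
  obtain v' where v': "v' \<in> carrier R" "v' \<otimes> v = \<one>" "v \<otimes> v' = \<one>"
    using assms(2) by (rule gr_units_inverse)
  have cl: "u \<in> carrier A" "v \<in> carrier A" "u' \<in> carrier A" "v' \<in> carrier A"
    using assms u' v' by auto
  have "(v' \<otimes> u') \<otimes> (u \<otimes> v) = v' \<otimes> ((u' \<otimes> u) \<otimes> v)"
    using cl by (simp only: m_assoc m_closed)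
  also have "\<dots> = \<one>" using u'(2) v'(2) cl by simp
  finally have left: "(v' \<otimes> u') \<otimes> (u \<otimes> v) = \<one>" .
  have "(u \<otimes> v) \<otimes> (v' \<otimes> u') = u \<otimes> ((v \<otimes> v') \<otimes> u')"
    using cl by (simp only: m_assoc m_closed)
  also have "\<dots> = \<one>" using u'(3) v'(3) cl by simp
  finally have right: "(u \<otimes> v) \<otimes> (v' \<otimes> u') = \<one>" .
  have "u \<otimes> v \<in> gr 0"
    using gr_ops(5)[of u 0 v 0] assms gr_units_gr by simp
  then show ?thesis
    unfolding gr_units_def using left right R_closed(2)[OF v'(1) u'(1)] by blast
qed

lemma \<sigma>_gr_units:
  assumes i: "1 \<le> i" "i \<le> n" and u: "u \<in> gr_units"
  shows "\<sigma> i u \<in> gr_units"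
proof -
  obtain v where v: "v \<in> carrier R" "v \<otimes> u = \<one>" "u \<otimes> v = \<one>"
    using u by (rule gr_units_inverse)
  have "\<sigma> i v \<otimes> \<sigma> i u = \<one>" "\<sigma> i u \<otimes> \<sigma> i v = \<one>"
    using \<sigma>_facts(3)[OF i v(1) gr_units_R[OF u]] \<sigma>_facts(3)[OF i gr_units_R[OF u] v(1)]
      \<sigma>_facts(4)[OF i] v(2,3) by simp_all
  then show ?thesis
    unfolding gr_units_def using \<sigma>_gr[OF i gr_units_gr[OF u]] \<sigma>_facts(1)[OF i v(1)] by blast
qed

lemma c_gr_units:
  assumes "1 \<le> i" "i < j" "j \<le> n"
  shows "c i j \<in> gr_units"
proof -
  from c_unit[OF assms] obtain v where "c i j \<in> gr 0" "v \<in> carrier R"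
    "v \<otimes>\<^bsub>R\<^esub> c i j = \<one>\<^bsub>R\<^esub>" "c i j \<otimes>\<^bsub>R\<^esub> v = \<one>\<^bsub>R\<^esub>"
    unfolding Units_def by blast
  then show ?thesis unfolding gr_units_def using gr_R by auto
qed

text \<open>Elements past which coefficients move from right to left, degree by degree. Units have a
  clause of their own, so that a unit created by reordering is still a unit after it has been moved
  to the front.\<close>

definition normalizing :: "'a set" where
  "normalizing = {m \<in> carrier A.
     (\<forall>t. \<forall>s\<in>gr t. \<exists>s'\<in>gr t. m \<otimes> s = s' \<otimes> m) \<and>
     (\<forall>u\<in>gr_units. \<exists>u'\<in>gr_units. m \<otimes> u = u' \<otimes> m)}"

lemma normalizing_carrier: "m \<in> normalizing \<Longrightarrow> m \<in> carrier A"
  by (simp add: normalizing_def)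

lemma normalizing_gr:
  assumes "m \<in> normalizing" "s \<in> gr t"
  obtains s' where "s' \<in> gr t" "m \<otimes> s = s' \<otimes> m"
  using assms unfolding normalizing_def by blast

lemma normalizing_unit:
  assumes "m \<in> normalizing" "u \<in> gr_units"
  obtains u' where "u' \<in> gr_units" "m \<otimes> u = u' \<otimes> m"
  using assms unfolding normalizing_def by blast

lemma one_normalizing: "\<one> \<in> normalizing"
proof -
  have "\<one> \<otimes> s = s \<otimes> \<one>" if "s \<in> carrier R" for s using that by simp
  then show ?thesis
    unfolding normalizing_def using gr_R gr_units_R one_closed by blast
qed

lemma mult_normalizing:
  assumes "m \<in> normalizing" "m' \<in> normalizing"
  shows "m \<otimes> m' \<in> normalizing"
proof -
  have cl: "m \<in> carrier A" "m' \<in> carrier A" using assms normalizing_carrier by auto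
  have *: "m \<otimes> m' \<otimes> s = s'' \<otimes> (m \<otimes> m')"
    if "s \<in> carrier A" "s' \<in> carrier A" "s'' \<in> carrier A" "m' \<otimes> s = s' \<otimes> m'" "m \<otimes> s' = s'' \<otimes> m"
    for s s' s''
  proof -
    have "m \<otimes> m' \<otimes> s = m \<otimes> (s' \<otimes> m')" using that(1,4) cl by (simp add: m_assoc)
    also have "\<dots> = m \<otimes> s' \<otimes> m'" using that(2) cl by (simp add: m_assoc)
    also have "\<dots> = s'' \<otimes> (m \<otimes> m')" using that(3,5) cl by (simp add: m_assoc)
    finally show ?thesis .
  qed
  have "\<exists>s''\<in>gr t. m \<otimes> m' \<otimes> s = s'' \<otimes> (m \<otimes> m')" if s: "s \<in> gr t" for t s
  proof -
    obtain s' where s': "s' \<in> gr t" "m' \<otimes> s = s' \<otimes> m'" by (rule normalizing_gr[OF assms(2) s])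
    obtain s'' where s'': "s'' \<in> gr t" "m \<otimes> s' = s'' \<otimes> m" by (rule normalizing_gr[OF assms(1) s'(1)])
    show ?thesis using *[OF _ _ _ s'(2) s''(2)] s s' s'' gr_R R_carrier by blast
  qed
  moreover have "\<exists>u''\<in>gr_units. m \<otimes> m' \<otimes> u = u'' \<otimes> (m \<otimes> m')" if u: "u \<in> gr_units" for u
  proof -
    obtain u' where u': "u' \<in> gr_units" "m' \<otimes> u = u' \<otimes> m'" by (rule normalizing_unit[OF assms(2) u])
    obtain u'' where u'': "u'' \<in> gr_units" "m \<otimes> u' = u'' \<otimes> m" by (rule normalizing_unit[OF assms(1) u'(1)])
    show ?thesis using *[OF _ _ _ u'(2) u''(2)] u u' u'' gr_units_R R_carrier by blast
  qed
  ultimately show ?thesis unfolding normalizing_def using m_closed[OF cl] by blast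
qed

lemma pow_normalizing: "m \<in> normalizing \<Longrightarrow> m [^] (q :: nat) \<in> normalizing"
  by (induction q) (auto simp: one_normalizing mult_normalizing)

lemma x_normalizing:
  assumes "1 \<le> i" "i \<le> n"
  shows "x i \<in> normalizing"
  unfolding normalizing_def
  using x_R[OF assms] \<sigma>_gr[OF assms] \<sigma>_gr_units[OF assms] x_closed[OF assms] gr_R gr_units_R
  by blast

lemma std_mono_normalizing: "k \<le> n \<Longrightarrow> std_mono A x k \<alpha> \<in> normalizing"
  by (induction k) (auto simp: one_normalizing mult_normalizing pow_normalizing x_normalizing)

definition skew_commute :: "'a \<Rightarrow> 'a \<Rightarrow> bool" where
  "skew_commute m m' \<longleftrightarrow> (\<exists>u\<in>gr_units. m \<otimes> m' = u \<otimes> (m' \<otimes> m))"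

lemma skew_commute_one:
  assumes "y \<in> carrier A"
  shows "skew_commute \<one> y" "skew_commute y \<one>"
  unfolding skew_commute_def using assms one_gr_units by (auto intro!: bexI[of _ \<one>])

text \<open>Moving \<open>y\<close> past \<open>m'\<close> leaves a unit between \<open>m\<close>
  and the rest. Since \<open>m\<close> is normalizing, that unit passes to the front, where it meets
  the unit from moving \<open>y\<close> past \<open>m\<close>.\<close>

lemma skew_commute_mult_left:
  assumes "m \<in> normalizing" "m' \<in> carrier A" "y \<in> carrier A"
    and "skew_commute m y" "skew_commute m' y"
  shows "skew_commute (m \<otimes> m') y"
proof -
  obtain u where u: "u \<in> gr_units" "m \<otimes> y = u \<otimes> (y \<otimes> m)"
    using assms(4) unfolding skew_commute_def by blast
  obtain v where v: "v \<in> gr_units" "m' \<otimes> y = v \<otimes> (y \<otimes> m')"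
    using assms(5) unfolding skew_commute_def by blast
  obtain w where w: "w \<in> gr_units" "m \<otimes> v = w \<otimes> m" by (rule normalizing_unit[OF assms(1) v(1)])
  have cl: "m \<in> carrier A" "u \<in> carrier A" "v \<in> carrier A" "w \<in> carrier A"
    using normalizing_carrier[OF assms(1)] u v w by auto
  have "m \<otimes> m' \<otimes> y = m \<otimes> v \<otimes> (y \<otimes> m')"
    using cl assms(2,3) v(2) by (simp add: m_assoc)
  also have "\<dots> = w \<otimes> (m \<otimes> y) \<otimes> m'"
    using cl assms(2,3) w(2) by (simp add: m_assoc)
  also have "\<dots> = w \<otimes> u \<otimes> (y \<otimes> (m \<otimes> m'))"
    using cl assms(2,3) u(2) by (simp add: m_assoc)
  finally show ?thesis
    using mult_gr_units[OF w(1) u(1)] unfolding skew_commute_def by blast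
qed

lemma skew_commute_mult_right:
  assumes "m \<in> normalizing" "m' \<in> carrier A" "y \<in> carrier A"
    and "skew_commute y m" "skew_commute y m'"
  shows "skew_commute y (m \<otimes> m')"
proof -
  obtain u where u: "u \<in> gr_units" "y \<otimes> m = u \<otimes> (m \<otimes> y)"
    using assms(4) unfolding skew_commute_def by blast
  obtain v where v: "v \<in> gr_units" "y \<otimes> m' = v \<otimes> (m' \<otimes> y)"
    using assms(5) unfolding skew_commute_def by blast
  obtain w where w: "w \<in> gr_units" "m \<otimes> v = w \<otimes> m" by (rule normalizing_unit[OF assms(1) v(1)])
  have cl: "m \<in> carrier A" "u \<in> carrier A" "v \<in> carrier A" "w \<in> carrier A"
    using normalizing_carrier[OF assms(1)] u v w by auto
  have "y \<otimes> (m \<otimes> m') = (y \<otimes> m) \<otimes> m'"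
    using cl assms(2,3) by (simp add: m_assoc)
  also have "\<dots> = u \<otimes> (m \<otimes> (y \<otimes> m'))"
    using cl assms(2,3) u(2) by (simp add: m_assoc)
  also have "\<dots> = u \<otimes> (m \<otimes> v \<otimes> (m' \<otimes> y))"
    using cl assms(2,3) v(2) by (simp add: m_assoc)
  also have "\<dots> = u \<otimes> w \<otimes> (m \<otimes> m' \<otimes> y)"
    using cl assms(2,3) w(2) by (simp add: m_assoc)
  finally show ?thesis
    using mult_gr_units[OF u(1) w(1)] unfolding skew_commute_def by blast
qed

lemma skew_commute_pow_left:
  assumes "m \<in> normalizing" "y \<in> carrier A" "skew_commute m y"
  shows "skew_commute (m [^] (q :: nat)) y"
  using assms normalizing_carrier[OF assms(1)]
  by (induction q) (auto simp: skew_commute_one pow_normalizing intro!: skew_commute_mult_left)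

lemma skew_commute_pow_right:
  assumes "m \<in> normalizing" "y \<in> carrier A" "skew_commute y m"
  shows "skew_commute y (m [^] (q :: nat))"
  using assms normalizing_carrier[OF assms(1)]
  by (induction q) (auto simp: skew_commute_one pow_normalizing intro!: skew_commute_mult_right)

lemma skew_commute_x: "\<lbrakk>1 \<le> i; i < j; j \<le> n\<rbrakk> \<Longrightarrow> skew_commute (x j) (x i)"
  using x_x c_gr_units unfolding skew_commute_def by blast

text \<open>All variables of the monomial have index below j, so only the relations with i < j,
  whose constants are units, are applied.\<close>

lemma skew_commute_std_mono: "\<lbrakk>k < j; j \<le> n\<rbrakk> \<Longrightarrow> skew_commute (x j) (std_mono A x k \<alpha>)"
  by (induction k)
    (auto intro!: skew_commute_one skew_commute_mult_right skew_commute_pow_right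
      std_mono_normalizing x_normalizing skew_commute_x)

section \<open>Stages and homogeneous parts described by coefficients\<close>

definition wt :: "(nat \<Rightarrow> nat) \<Rightarrow> nat" where
  "wt \<alpha> = (\<Sum>i\<in>{1..n}. \<alpha> i)"

lemma wt_zero_exp [simp]: "wt zero_exp = 0"
  by (simp add: wt_def zero_exp_def)

lemma wt_upd:
  assumes "1 \<le> j" "j \<le> n" "\<alpha> j = 0"
  shows "wt (\<alpha>(j := q)) = wt \<alpha> + q"
proof -
  have "wt (\<alpha>(j := q)) = q + (\<Sum>i\<in>{1..n} - {j}. (\<alpha>(j := q)) i)"
    unfolding wt_def using assms by (subst sum.remove[of _ j]) auto
  also have "\<dots> = q + (\<Sum>i\<in>{1..n} - {j}. \<alpha> i)"
    by (intro arg_cong[of _ _ "(+) q"] sum.cong) auto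
  also have "\<dots> = wt \<alpha> + q"
    unfolding wt_def using assms by (subst (2) sum.remove[of _ j]) auto
  finally show ?thesis .
qed

text \<open>A support condition instead of a span, so that vanishing and cancellation can be tested
  one coordinate at a time; closure under products then has to be earned.\<close>

definition stage :: "nat \<Rightarrow> 'a set" where
  "stage k = {a \<in> carrier A. \<forall>\<alpha>. coef a \<alpha> \<noteq> \<zero> \<longrightarrow> \<alpha> \<in> exps k}"

text \<open>The degree-\<open>p\<close> part of stage \<open>k\<close>. The inequality
  \<open>wt \<alpha> \<le> p\<close> is separate because truncated subtraction would otherwise admit
  monomials that are too heavy, with coefficients of degree 0.\<close>

definition piece :: "nat \<Rightarrow> nat \<Rightarrow> 'a set" where
  "piece k p = {a \<in> carrier A. \<forall>\<alpha>. coef a \<alpha> \<noteq> \<zero> \<longrightarrow>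
     \<alpha> \<in> exps k \<and> wt \<alpha> \<le> p \<and> coef a \<alpha> \<in> gr (p - wt \<alpha>)}"

lemma stage_carrier: "a \<in> stage k \<Longrightarrow> a \<in> carrier A"
  by (simp add: stage_def)

lemma piece_stage: "a \<in> piece k p \<Longrightarrow> a \<in> stage k"
  by (simp add: piece_def stage_def)

lemma piece_carrier: "a \<in> piece k p \<Longrightarrow> a \<in> carrier A"
  by (simp add: piece_def)

lemma stage_mono: "k \<le> l \<Longrightarrow> stage k \<subseteq> stage l"
  using exps_mono by (auto simp: stage_def)

lemma piece_mono: "k \<le> l \<Longrightarrow> piece k p \<subseteq> piece l p"
  using exps_mono by (auto simp: piece_def)

lemma stage_n: "stage n = carrier A"
proof -
  have "\<alpha> \<in> exponents n" if "a \<in> carrier A" "coef a \<alpha> \<noteq> \<zero>" for a \<alpha>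
    using expansionE[OF that(1)] that(2) by (metis subsetD)
  then show ?thesis by (auto simp: stage_def exps_n)
qed

lemma term_piece:
  assumes "r \<in> gr t" "\<alpha> \<in> exps k" "t + wt \<alpha> = p"
  shows "r \<otimes> monomial \<alpha> \<in> piece k p"
  using assms coef_mono[of r \<alpha> k] by (auto simp: piece_def)

lemma zero_piece: "\<zero> \<in> piece k p"
  by (simp add: piece_def)

lemma add_piece:
  assumes "a \<in> piece k p" "b \<in> piece k p"
  shows "a \<oplus> b \<in> piece k p"
proof -
  have cl: "a \<in> carrier A" "b \<in> carrier A" using assms piece_carrier by auto
  have "\<alpha> \<in> exps k \<and> wt \<alpha> \<le> p \<and> coef a \<alpha> \<oplus> coef b \<alpha> \<in> gr (p - wt \<alpha>)"
    if ne: "coef a \<alpha> \<oplus> coef b \<alpha> \<noteq> \<zero>" for \<alpha>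
  proof -
    have "coef a \<alpha> \<noteq> \<zero> \<or> coef b \<alpha> \<noteq> \<zero>" using ne by auto
    then have "\<alpha> \<in> exps k \<and> wt \<alpha> \<le> p" using assms by (auto simp: piece_def)
    moreover have "coef a \<alpha> \<in> gr (p - wt \<alpha>)" "coef b \<alpha> \<in> gr (p - wt \<alpha>)"
      using assms gr_ops(1) by (auto simp: piece_def, metis+)
    ultimately show ?thesis using gr_ops(3) by blast
  qed
  then show ?thesis using cl coef_add[OF cl] by (simp add: piece_def)
qed

lemma piece_induct [consumes 1, case_names zero add summand]:
  assumes a: "a \<in> piece k p" and zero: "P \<zero>"
    and add: "\<And>a a'. \<lbrakk>a \<in> carrier A; a' \<in> carrier A; P a; P a'\<rbrakk> \<Longrightarrow> P (a \<oplus> a')"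
    and summand: "\<And>r t \<alpha>. \<lbrakk>r \<in> gr t; \<alpha> \<in> exps k; t + wt \<alpha> = p\<rbrakk> \<Longrightarrow> P (r \<otimes> monomial \<alpha>)"
  shows "P a"
  using piece_carrier[OF a]
proof (rule expansion_induct)
  fix \<alpha> assume "coef a \<alpha> \<noteq> \<zero>"
  then show "P (coef a \<alpha> \<otimes> monomial \<alpha>)"
    using a by (intro summand[of _ "p - wt \<alpha>"]) (auto simp: piece_def)
qed (use zero add in auto)

text \<open>The coefficients of a general element are inhomogeneous, so each term is split once more
  by decomposing its coefficient in \<open>R\<close>. Zero falls under the \<open>piece\<close>
  case.\<close>

lemma stage_induct [consumes 1, case_names add piece]:
  assumes a: "a \<in> stage k"
    and add: "\<And>a a'. \<lbrakk>a \<in> carrier A; a' \<in> carrier A; P a; P a'\<rbrakk> \<Longrightarrow> P (a \<oplus> a')"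
    and piece: "\<And>a p. a \<in> piece k p \<Longrightarrow> P a"
  shows "P a"
  using stage_carrier[OF a]
proof (rule expansion_induct)
  fix \<alpha> assume "coef a \<alpha> \<noteq> \<zero>"
  then have \<alpha>: "\<alpha> \<in> exps k" using a by (simp add: stage_def)
  have "coef a \<alpha> \<in> carrier R" using stage_carrier[OF a] by simp
  then show "P (coef a \<alpha> \<otimes> monomial \<alpha>)"
    by (induction rule: GR.homogeneous_induct)
      (use add in \<open>auto simp: l_distr intro!: piece term_piece \<alpha>\<close>)
qed (use add piece zero_piece in auto)

lemma R_piece: "r \<in> gr t \<Longrightarrow> r \<in> piece k t"
  using term_piece[OF _ zero_exp_in, of r t t k] by simp

lemma a_inv_piece: "a \<in> piece k p \<Longrightarrow> \<ominus> a \<in> piece k p"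
proof (induction rule: piece_induct)
  case (summand r t \<alpha>)
  then show ?case using term_piece[of "\<ominus> r" t \<alpha> k p] gr_ops(4) by (simp add: l_minus)
qed (auto simp: zero_piece minus_add add_piece)

lemma smult_piece:
  assumes "k \<in> carrier K"
  shows "a \<in> piece l p \<Longrightarrow> k \<odot> a \<in> piece l p"
proof (induction rule: piece_induct)
  case (summand r t \<alpha>)
  then show ?case
    using assms term_piece[of "k \<odot> r" t \<alpha> l p] gr_ops(6)[of k r t] by (simp add: AA.smult_mult_left)
qed (use assms in \<open>auto simp: zero_piece AA.M.smult_r_distr add_piece\<close>)

section \<open>Products of homogeneous elements\<close>

lemma mult_gr_piece:
  assumes s: "s \<in> gr q"
  shows "a \<in> piece k p \<Longrightarrow> a \<otimes> s \<in> piece k (p + q)"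
proof (induction rule: piece_induct)
  case (summand r t \<alpha>)
  obtain s' where s': "s' \<in> gr q" "monomial \<alpha> \<otimes> s = s' \<otimes> monomial \<alpha>"
    using normalizing_gr[OF std_mono_normalizing s] by blast
  have "r \<otimes> monomial \<alpha> \<otimes> s = (r \<otimes> s') \<otimes> monomial \<alpha>"
    using summand s s' by (simp add: m_assoc)
  then show ?case
    using term_piece[of "r \<otimes> s'" "t + q" \<alpha> k "p + q"] gr_ops(5)[of r t s' q] summand s' by simp
qed (use s in \<open>auto simp: zero_piece add_piece l_distr\<close>)

lemma mult_x_pow_piece:
  assumes "k < n"
  shows "a \<in> piece k p \<Longrightarrow> a \<otimes> x (Suc k) [^] (q :: nat) \<in> piece (Suc k) (p + q)"
proof (induction rule: piece_induct)
  case (summand r t \<alpha>)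
  have "\<alpha> (Suc k) = 0" using summand assms by (auto simp: exps_def)
  then have "t + wt (\<alpha>(Suc k := q)) = p + q"
    using summand assms wt_upd[of "Suc k" \<alpha> q] by simp
  then have "r \<otimes> monomial (\<alpha>(Suc k := q)) \<in> piece (Suc k) (p + q)"
    using summand assms by (intro term_piece[of r t] exps_upd[of \<alpha> k]) auto
  then show ?case
    using summand assms mono_upd[of \<alpha> k q] by (simp add: m_assoc)
qed (use assms in \<open>auto simp: zero_piece add_piece l_distr\<close>)

text \<open>In a standard monomial of stage \<open>Suc k\<close> the power of
  \<open>x (Suc k)\<close> is rightmost. Splitting it off leaves a factor in stage \<open>k\<close>,
  which makes induction on the number of variables possible.\<close>

lemma piece_Suc_induct [consumes 2, case_names zero add summand]:
  assumes "k < n" "a \<in> piece (Suc k) p" and "P \<zero>"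
    and "\<And>a a'. \<lbrakk>a \<in> carrier A; a' \<in> carrier A; P a; P a'\<rbrakk> \<Longrightarrow> P (a \<oplus> a')"
    and summand: "\<And>b t q. \<lbrakk>b \<in> piece k t; t + q = p\<rbrakk> \<Longrightarrow> P (b \<otimes> x (Suc k) [^] (q :: nat))"
  shows "P a"
  using assms(2)
proof (rule piece_induct)
  fix r t \<alpha> assume *: "r \<in> gr t" "\<alpha> \<in> exps (Suc k)" "t + wt \<alpha> = p"
  define \<beta> where "\<beta> = \<alpha>(Suc k := 0)"
  define q where "q = \<alpha> (Suc k)"
  have \<alpha>: "\<alpha> = \<beta>(Suc k := q)" by (simp add: \<beta>_def q_def)
  have \<beta>: "\<beta> \<in> exps k" unfolding \<beta>_def by (rule exps_del) fact+
  have "wt \<alpha> = wt \<beta> + q" unfolding \<alpha> using assms(1) by (intro wt_upd) (auto simp: \<beta>_def)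
  then have "P (r \<otimes> monomial \<beta> \<otimes> x (Suc k) [^] q)"
    using * \<beta> by (intro summand[of _ "t + wt \<beta>"] term_piece[of r t]) auto
  then show "P (r \<otimes> monomial \<alpha>)"
    unfolding \<alpha> using mono_upd[OF \<beta> assms(1)] * assms(1) by (simp add: m_assoc)
qed (use assms in auto)

text \<open>For \<open>i = Suc k\<close> the powers of the last variable merge. Otherwise
  \<open>x i\<close> moves left across that power at the cost of a unit \<open>u\<close> of degree
  0; \<open>u\<close> is absorbed into the stage-\<open>k\<close> factor, and the induction
  hypothesis applies to the modified factor, hence the generalization over \<open>a\<close> and
  \<open>p\<close>.\<close>

lemma mult_x_piece:
  assumes "k \<le> n" "1 \<le> i" "i \<le> k" "a \<in> piece k p"
  shows "a \<otimes> x i \<in> piece k (Suc p)"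
  using assms
proof (induction k arbitrary: i a p)
  case (Suc k)
  have k: "k < n" using Suc.prems by simp
  from k Suc.prems(4) show ?case
  proof (induction rule: piece_Suc_induct)
    case (summand b t q)
    have b: "b \<in> carrier A" using summand piece_carrier by auto
    show ?case
    proof (cases "i = Suc k")
      case True
      then show ?thesis
        using mult_x_pow_piece[OF k summand(1), of "Suc q"] summand b k by (simp add: m_assoc)
    next
      case False
      then have i: "1 \<le> i" "i < Suc k" "i \<le> k" "i \<le> n" using Suc.prems by auto
      have "skew_commute (x (Suc k) [^] q) (x i)"
        using i k by (intro skew_commute_pow_left x_normalizing skew_commute_x) auto
      then obtain u where u: "u \<in> gr_units" "x (Suc k) [^] q \<otimes> x i = u \<otimes> (x i \<otimes> x (Suc k) [^] q)"
        unfolding skew_commute_def by blast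
      have "b \<otimes> u \<in> piece k t" using mult_gr_piece[OF gr_units_gr[OF u(1)] summand(1)] by simp
      then have "b \<otimes> u \<otimes> x i \<in> piece k (Suc t)" using Suc.IH i k by simp
      then have "b \<otimes> u \<otimes> x i \<otimes> x (Suc k) [^] q \<in> piece (Suc k) (Suc t + q)"
        by (rule mult_x_pow_piece[OF k])
      moreover have "b \<otimes> x (Suc k) [^] q \<otimes> x i = b \<otimes> u \<otimes> x i \<otimes> x (Suc k) [^] q"
        using b u i k by (simp add: m_assoc)
      ultimately show ?thesis using summand by simp
    qed
  qed (use Suc.prems in \<open>auto simp: zero_piece add_piece l_distr\<close>)
qed simp

lemma mult_mono_piece:
  assumes k: "k \<le> n" and \<beta>: "\<beta> \<in> exps k" and a: "a \<in> piece k p"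
  shows "a \<otimes> monomial \<beta> \<in> piece k (p + wt \<beta>)"
proof -
  have pow: "a \<otimes> x i [^] q \<in> piece k (p + q)" if "1 \<le> i" "i \<le> k" "a \<in> piece k p" for i a p and q :: nat
  proof (induction q)
    case 0
    then show ?case using that piece_carrier[of a] by simp
  next
    case (Suc q)
    then have "a \<otimes> x i [^] q \<otimes> x i \<in> piece k (Suc (p + q))"
      using mult_x_piece k that by blast
    then show ?case using that piece_carrier[of a] k by (simp add: m_assoc)
  qed
  \<comment> \<open>The variables of \<beta> are multiplied in one after the other. The prefix
    length runs up to n since \<open>monomial\<close> is the full product; beyond k the exponents
    vanish and nothing changes.\<close>
  have "a \<otimes> std_mono A x j \<beta> \<in> piece k (p + (\<Sum>i\<in>{1..j}. \<beta> i))" if "j \<le> n" for j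
    using that
  proof (induction j)
    case 0
    then show ?case using a piece_carrier[of a] by simp
  next
    case (Suc j)
    then have IH: "a \<otimes> std_mono A x j \<beta> \<in> piece k (p + (\<Sum>i\<in>{1..j}. \<beta> i))" by simp
    show ?case
    proof (cases "Suc j \<le> k")
      case True
      then show ?thesis
        using pow[OF _ True IH, of "\<beta> (Suc j)"] Suc.prems a piece_carrier[of a] by (simp add: m_assoc add.assoc)
    next
      case False
      then have "\<beta> (Suc j) = 0" using \<beta> Suc.prems by (simp add: exps_def)
      then show ?thesis using IH Suc.prems a piece_carrier[of a] by simp
    qed
  qed
  then show ?thesis by (simp add: wt_def)
qed

text \<open>A term of \<open>b\<close> is multiplied in two steps: its coefficient crosses the
  monomials of \<open>a\<close>, then its monomial is multiplied in variable by variable.\<close>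

lemma mult_piece:
  assumes "k \<le> n" "a \<in> piece k p"
  shows "b \<in> piece k q \<Longrightarrow> a \<otimes> b \<in> piece k (p + q)"
proof (induction rule: piece_induct)
  case (summand r t \<alpha>)
  have "a \<otimes> r \<otimes> monomial \<alpha> \<in> piece k (p + t + wt \<alpha>)"
    using assms summand by (intro mult_mono_piece mult_gr_piece) auto
  then show ?case using assms summand piece_carrier[of a] by (simp add: m_assoc add.assoc)
qed (use assms piece_carrier[of a] in \<open>auto simp: zero_piece add_piece r_distr\<close>)

section \<open>Stages as subalgebras\<close>

lemma add_stage:
  assumes "a \<in> stage k" "b \<in> stage k"
  shows "a \<oplus> b \<in> stage k"
proof -
  have cl: "a \<in> carrier A" "b \<in> carrier A" using assms stage_carrier by auto
  have "\<alpha> \<in> exps k" if "coef a \<alpha> \<oplus> coef b \<alpha> \<noteq> \<zero>" for \<alpha>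
  proof -
    have "coef a \<alpha> \<noteq> \<zero> \<or> coef b \<alpha> \<noteq> \<zero>" using that by auto
    then show ?thesis using assms unfolding stage_def by blast
  qed
  then show ?thesis using cl coef_add[OF cl] by (simp add: stage_def)
qed

lemma term_stage: "\<lbrakk>r \<in> carrier R; \<alpha> \<in> exps k\<rbrakk> \<Longrightarrow> r \<otimes> monomial \<alpha> \<in> stage k"
  using coef_mono[of r \<alpha> k] by (simp add: stage_def)

lemma R_stage: "r \<in> carrier R \<Longrightarrow> r \<in> stage k"
  using term_stage[OF _ zero_exp_in] by simp

text \<open>Together with \<open>piece_0\<close> this puts \<open>R\<close>, with its given grading,
  at the bottom of the tower.\<close>

lemma stage_0: "stage 0 = carrier R"
proof
  show "stage 0 \<subseteq> carrier R"
  proof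
    fix a assume a: "a \<in> stage 0"
    then have aA: "a \<in> carrier A" by (rule stage_carrier)
    have "coef a i = \<zero>" if "i \<noteq> zero_exp" for i
      using a that unfolding stage_def exps_0 by blast
    then have "coef (coef a zero_exp) i = coef a i" for i
      unfolding coef_R[OF coef_closed[OF aA]] by (cases "i = zero_exp") simp_all
    then have "coef a zero_exp = a"
      using aA R_carrier[OF coef_closed[OF aA]] by - (rule coef_eqI)
    then show "a \<in> carrier R" using coef_closed[OF aA, of zero_exp] by (simp only:)
  qed
qed (use R_stage in blast)

lemma piece_0: "piece 0 p = gr p"
proof
  show "piece 0 p \<subseteq> gr p"
  proof
    fix a assume a: "a \<in> piece 0 p"
    then have aR: "a \<in> carrier R" using piece_stage stage_0 by blast
    then have "coef a zero_exp = a" by (simp add: coef_R)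
    moreover have "coef a zero_exp \<noteq> \<zero> \<longrightarrow> coef a zero_exp \<in> gr (p - wt zero_exp)"
      using a unfolding piece_def by blast
    ultimately show "a \<in> gr p" using gr_ops(1)[of p] by (cases "a = \<zero>") simp_all
  qed
qed (use R_piece in blast)

lemma a_inv_stage: "a \<in> stage k \<Longrightarrow> \<ominus> a \<in> stage k"
proof (induction rule: stage_induct)
  case (piece a p)
  then show ?case using a_inv_piece piece_stage by blast
qed (simp add: minus_add add_stage)

lemma smult_stage:
  assumes "s \<in> carrier K"
  shows "a \<in> stage k \<Longrightarrow> s \<odot> a \<in> stage k"
proof (induction rule: stage_induct)
  case (piece a p)
  then show ?case using smult_piece[OF assms] piece_stage by blast
qed (simp add: AA.M.smult_r_distr assms add_stage)

lemma mult_stage: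
  assumes k: "k \<le> n" and a: "a \<in> stage k" and b: "b \<in> stage k"
  shows "a \<otimes> b \<in> stage k"
  using a
proof (induction rule: stage_induct)
  case (piece a p)
  from b show ?case
  proof (induction rule: stage_induct)
    case (piece b q)
    then show ?case using mult_piece[OF k \<open>a \<in> piece k p\<close>] piece_stage by blast
  qed (simp add: r_distr piece_carrier[OF piece] add_stage)
qed (simp add: l_distr stage_carrier[OF b] add_stage)

lemma x_piece: "\<lbrakk>1 \<le> i; i \<le> k; k \<le> n\<rbrakk> \<Longrightarrow> x i \<in> piece k 1"
  using mult_x_piece[of k i \<one> 0] R_piece[OF gr_ops(2)] by simp

lemma subalg_stage:
  assumes k: "k \<le> n"
  shows "subalg K (A\<lparr>carrier := stage k\<rparr>) A"
proof -
  have sub: "stage k \<subseteq> carrier A" using stage_carrier by blast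
  have "subring (stage k) A"
    by (intro subringI sub R_stage[OF one_in_R] a_inv_stage mult_stage[OF k] add_stage)
  then have "ring (A\<lparr>carrier := stage k\<rparr>)" by (rule subring_is_ring)
  moreover have "submodule (stage k) K A"
    by (intro AA.M.submoduleI sub R_stage[OF zero_in_R] a_inv_stage add_stage smult_stage)
  then have "Module.module K (A\<lparr>carrier := stage k\<rparr>)"
    using submodule.submodule_is_module AA.M.module_axioms by blast
  ultimately have "k_algebra K (A\<lparr>carrier := stage k\<rparr>)"
  proof (intro k_algebra.intro k_algebra_axioms.intro)
    show "field K" by (rule k_algebra.axioms(1)[OF alg_A])
    fix s a b
    assume "s \<in> carrier K" "a \<in> carrier (A\<lparr>carrier := stage k\<rparr>)" "b \<in> carrier (A\<lparr>carrier := stage k\<rparr>)"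
    then have "s \<in> carrier K" "a \<in> carrier A" "b \<in> carrier A" using stage_carrier by auto
    then show "(s \<odot>\<^bsub>A\<lparr>carrier := stage k\<rparr>\<^esub> a) \<otimes>\<^bsub>A\<lparr>carrier := stage k\<rparr>\<^esub> b =
        s \<odot>\<^bsub>A\<lparr>carrier := stage k\<rparr>\<^esub> (a \<otimes>\<^bsub>A\<lparr>carrier := stage k\<rparr>\<^esub> b)"
      "a \<otimes>\<^bsub>A\<lparr>carrier := stage k\<rparr>\<^esub> (s \<odot>\<^bsub>A\<lparr>carrier := stage k\<rparr>\<^esub> b) =
        s \<odot>\<^bsub>A\<lparr>carrier := stage k\<rparr>\<^esub> (a \<otimes>\<^bsub>A\<lparr>carrier := stage k\<rparr>\<^esub> b)"
      using AA.smult_mult_left[of s a b] AA.smult_mult_right[of s a b] by simp_all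
  qed
  then show ?thesis
    using alg_A sub by (auto simp: subalg_def alg_hom_def ring_hom_def)
qed

section \<open>The twisting automorphism of each variable\<close>

text \<open>Right multiplication by a power of the new variable merely relabels exponents and keeps
  the coefficients. This is freeness in the form used for cancellation and for the basis of
  powers.\<close>

lemma coef_mult_x_pow:
  assumes k: "k < n" and \<beta>: "\<beta> \<in> exps k"
  shows "b \<in> stage k \<Longrightarrow> coef (b \<otimes> x (Suc k) [^] (q :: nat)) (\<beta>(Suc k := p)) =
    (if p = q then coef b \<beta> else \<zero>)"
proof (induction rule: stage_induct)
  case (add a a')
  then show ?case using k by (simp add: l_distr coef_add)
next
  case (piece a d)
  then show ?case
  proof (induction rule: piece_induct)
    case zero
    then show ?case using k by simp
  next
    case (add a a')
    then show ?case using k by (simp add: l_distr coef_add)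
  next
    case (summand r t \<alpha>)
    have r: "r \<in> carrier R" using summand(1) by (rule gr_R)
    have "r \<otimes> monomial \<alpha> \<otimes> x (Suc k) [^] q = r \<otimes> monomial (\<alpha>(Suc k := q))"
      using r k mono_upd[OF summand(2) k] by (simp add: m_assoc)
    moreover have "\<alpha>(Suc k := q) \<in> exps (Suc k)"
      using summand(2) k by (intro exps_upd[of \<alpha> k]) auto
    \<comment> \<open>Both exponents vanish at \<open>Suc k\<close>, so they can be recovered from
      their updates.\<close>
    moreover have "\<beta>(Suc k := p) = \<alpha>(Suc k := q) \<longleftrightarrow> \<beta> = \<alpha> \<and> p = q"
    proof
      assume eq: "\<beta>(Suc k := p) = \<alpha>(Suc k := q)"
      have "\<beta> (Suc k) = 0" "\<alpha> (Suc k) = 0" using \<beta> summand(2) k by (simp_all add: exps_def)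
      then have "\<beta> = (\<beta>(Suc k := p))(Suc k := 0)" "\<alpha> = (\<alpha>(Suc k := q))(Suc k := 0)"
        by (auto simp: fun_eq_iff)
      with eq show "\<beta> = \<alpha> \<and> p = q" by (metis fun_upd_same)
    qed auto
    ultimately show ?case
      unfolding coef_mono[OF r summand(2)] by (simp only: coef_mono[OF r]) simp
  qed
qed

lemma mult_x_cancel:
  assumes k: "k < n" and b: "b \<in> stage k" "b' \<in> stage k"
    and eq: "b \<otimes> x (Suc k) = b' \<otimes> x (Suc k)"
  shows "b = b'"
proof (rule coef_eqI)
  fix \<beta>
  show "coef b \<beta> = coef b' \<beta>"
  proof (cases "\<beta> \<in> exps k")
    case True
    then show ?thesis
      using coef_mult_x_pow[OF k True b(1), of 1 1] coef_mult_x_pow[OF k True b(2), of 1 1] eq k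
      by simp
  next
    case False
    then have "coef b \<beta> = \<zero>" "coef b' \<beta> = \<zero>" using b unfolding stage_def by blast+
    then show ?thesis by simp
  qed
qed (use b stage_carrier in auto)

lemma x_mono:
  assumes k: "k < n" and \<alpha>: "\<alpha> \<in> exps k"
  obtains u where "u \<in> gr_units" "x (Suc k) \<otimes> monomial \<alpha> = u \<otimes> (monomial \<alpha> \<otimes> x (Suc k))"
  using skew_commute_std_mono[of k "Suc k" \<alpha>] mono_eq_std_mono[OF \<alpha>] k
  unfolding skew_commute_def by auto

text \<open>The automorphism on terms: \<open>r x^\<alpha>\<close> goes to
  \<open>\<sigma>(r) u x^\<alpha>\<close>, where \<open>u\<close> depends on the monomial but not on
  \<open>r\<close>.\<close>

lemma x_term:
  assumes k: "k < n" and \<alpha>: "\<alpha> \<in> exps k" and r: "r \<in> carrier R" and u: "u \<in> carrier R"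
    and eq: "x (Suc k) \<otimes> monomial \<alpha> = u \<otimes> (monomial \<alpha> \<otimes> x (Suc k))"
  shows "x (Suc k) \<otimes> (r \<otimes> monomial \<alpha>) = \<sigma> (Suc k) r \<otimes> u \<otimes> monomial \<alpha> \<otimes> x (Suc k)"
proof -
  have i: "1 \<le> Suc k" "Suc k \<le> n" using k by auto
  note cl = x_closed[OF i] mono_closed[of \<alpha>] R_carrier[OF r] R_carrier[OF u]
    R_carrier[OF \<sigma>_facts(1)[OF i r]]
  have "x (Suc k) \<otimes> (r \<otimes> monomial \<alpha>) = (x (Suc k) \<otimes> r) \<otimes> monomial \<alpha>"
    using cl by (simp only: m_assoc)
  also have "\<dots> = \<sigma> (Suc k) r \<otimes> (x (Suc k) \<otimes> monomial \<alpha>)"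
    unfolding x_R[OF i r] using cl by (simp only: m_assoc)
  also have "\<dots> = \<sigma> (Suc k) r \<otimes> u \<otimes> monomial \<alpha> \<otimes> x (Suc k)"
    unfolding eq using cl by (simp only: m_assoc m_closed)
  finally show ?thesis .
qed

lemma ex_twist_piece:
  assumes k: "k < n"
  shows "a \<in> piece k p \<Longrightarrow> \<exists>b\<in>piece k p. x (Suc k) \<otimes> a = b \<otimes> x (Suc k)"
proof (induction rule: piece_induct)
  case zero
  show ?case using zero_piece[of k p] k by (intro bexI[of _ \<zero>]) auto
next
  case (add a a')
  then obtain b b' where b: "b \<in> piece k p" "x (Suc k) \<otimes> a = b \<otimes> x (Suc k)"
    "b' \<in> piece k p" "x (Suc k) \<otimes> a' = b' \<otimes> x (Suc k)" by blast
  then have "x (Suc k) \<otimes> (a \<oplus> a') = (b \<oplus> b') \<otimes> x (Suc k)"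
    using add(1,2) k piece_carrier[OF b(1)] piece_carrier[OF b(3)] by (simp add: l_distr r_distr)
  then show ?case using add_piece[OF b(1,3)] by blast
next
  case (summand r t \<alpha>)
  obtain u where u: "u \<in> gr_units" "x (Suc k) \<otimes> monomial \<alpha> = u \<otimes> (monomial \<alpha> \<otimes> x (Suc k))"
    by (rule x_mono[OF k summand(2)])
  have "\<sigma> (Suc k) r \<otimes> u \<in> gr t"
    using gr_ops(5)[OF \<sigma>_gr[OF _ _ summand(1)] gr_units_gr[OF u(1)], of "Suc k"] k by simp
  then have "\<sigma> (Suc k) r \<otimes> u \<otimes> monomial \<alpha> \<in> piece k p"
    using summand by (intro term_piece[of _ t])
  then show ?case
    using x_term[OF k summand(2) gr_R[OF summand(1)] gr_units_R[OF u(1)] u(2)] by blast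
qed

lemma ex_twist:
  assumes k: "k < n"
  shows "a \<in> stage k \<Longrightarrow> \<exists>b\<in>stage k. x (Suc k) \<otimes> a = b \<otimes> x (Suc k)"
proof (induction rule: stage_induct)
  case (add a a')
  then obtain b b' where b: "b \<in> stage k" "x (Suc k) \<otimes> a = b \<otimes> x (Suc k)"
    "b' \<in> stage k" "x (Suc k) \<otimes> a' = b' \<otimes> x (Suc k)" by blast
  then have "x (Suc k) \<otimes> (a \<oplus> a') = (b \<oplus> b') \<otimes> x (Suc k)"
    using add(1,2) k stage_carrier[OF b(1)] stage_carrier[OF b(3)] by (simp add: l_distr r_distr)
  then show ?case using add_stage[OF b(1,3)] by blast
next
  case (piece a p)
  then show ?case using ex_twist_piece[OF k piece] piece_stage by blast
qed

text \<open>Surjectivity of the twisting map. On a term one has to solve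
  \<open>\<sigma>(s) u = r\<close>, which takes both the invertibility of \<open>u\<close> and the
  surjectivity of \<sigma>.\<close>

lemma ex_untwist:
  assumes k: "k < n"
  shows "b \<in> stage k \<Longrightarrow> \<exists>a\<in>stage k. x (Suc k) \<otimes> a = b \<otimes> x (Suc k)"
proof (induction rule: stage_induct)
  case (add b b')
  then obtain a a' where a: "a \<in> stage k" "x (Suc k) \<otimes> a = b \<otimes> x (Suc k)"
    "a' \<in> stage k" "x (Suc k) \<otimes> a' = b' \<otimes> x (Suc k)" by blast
  then have "x (Suc k) \<otimes> (a \<oplus> a') = (b \<oplus> b') \<otimes> x (Suc k)"
    using add(1,2) k stage_carrier[OF a(1)] stage_carrier[OF a(3)] by (simp add: l_distr r_distr)
  then show ?case using add_stage[OF a(1,3)] by blast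
next
  case (piece b p)
  then show ?case
  proof (induction rule: piece_induct)
    case zero
    show ?case using R_stage[OF zero_in_R, of k] k by (intro bexI[of _ \<zero>]) auto
  next
    case (add b b')
    then obtain a a' where a: "a \<in> stage k" "x (Suc k) \<otimes> a = b \<otimes> x (Suc k)"
      "a' \<in> stage k" "x (Suc k) \<otimes> a' = b' \<otimes> x (Suc k)" by blast
    then have "x (Suc k) \<otimes> (a \<oplus> a') = (b \<oplus> b') \<otimes> x (Suc k)"
      using add(1,2) k stage_carrier[OF a(1)] stage_carrier[OF a(3)] by (simp add: l_distr r_distr)
    then show ?case using add_stage[OF a(1,3)] by blast
  next
    case (summand r t \<alpha>)
    have r: "r \<in> carrier R" using summand(1) by (rule gr_R)
    obtain u where u: "u \<in> gr_units" "x (Suc k) \<otimes> monomial \<alpha> = u \<otimes> (monomial \<alpha> \<otimes> x (Suc k))"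
      by (rule x_mono[OF k summand(2)])
    obtain v where v: "v \<in> carrier R" "v \<otimes> u = \<one>" by (rule gr_units_inverse[OF u(1)])
    \<comment> \<open>The preimage of \<open>r v\<close> is the right coefficient: twisting it gives
      \<open>r v u = r\<close>.\<close>
    have "r \<otimes> v \<in> \<sigma> (Suc k) ` carrier R"
      using \<sigma>_bij[of "Suc k"] k R_closed(2)[OF r v(1)] by (simp add: bij_betw_def)
    then obtain s where s: "s \<in> carrier R" "\<sigma> (Suc k) s = r \<otimes> v" by auto
    have "r \<otimes> v \<otimes> u = r"
      using m_assoc[of r v u] r v gr_units_R[OF u(1)] by simp
    then have "x (Suc k) \<otimes> (s \<otimes> monomial \<alpha>) = r \<otimes> monomial \<alpha> \<otimes> x (Suc k)"
      using x_term[OF k summand(2) s(1) gr_units_R[OF u(1)] u(2)] s(2) by simp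
    then show ?case using term_stage[OF s(1) summand(2)] by blast
  qed
qed

text \<open>Left multiplication acts on each coordinate by \<sigma> followed by a fixed unit. The
  factor \<open>u\<close> is a parameter, so that two elements can be compared with the same
  \<open>u\<close>.\<close>

lemma coef_x_mult:
  assumes k: "k < n" and \<beta>: "\<beta> \<in> exps k" and u: "u \<in> carrier R"
    and eq: "x (Suc k) \<otimes> monomial \<beta> = u \<otimes> (monomial \<beta> \<otimes> x (Suc k))"
  shows "a \<in> stage k \<Longrightarrow> coef (x (Suc k) \<otimes> a) (\<beta>(Suc k := 1)) = \<sigma> (Suc k) (coef a \<beta>) \<otimes> u"
proof -
  have i: "1 \<le> Suc k" "Suc k \<le> n" using k by auto
  have \<sigma>_zero: "\<sigma> (Suc k) \<zero> = \<zero>"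
    using \<sigma>_facts(2)[OF i, of \<zero> \<zero>] \<sigma>_facts(1)[OF i, of \<zero>]
      add.r_cancel_one[of "\<sigma> (Suc k) \<zero>" "\<sigma> (Suc k) \<zero>"] by simp
  have add: "coef (x (Suc k) \<otimes> (a \<oplus> a')) (\<beta>(Suc k := 1)) = \<sigma> (Suc k) (coef (a \<oplus> a') \<beta>) \<otimes> u"
    if a: "a \<in> carrier A" "a' \<in> carrier A"
    and eqs: "coef (x (Suc k) \<otimes> a) (\<beta>(Suc k := 1)) = \<sigma> (Suc k) (coef a \<beta>) \<otimes> u"
      "coef (x (Suc k) \<otimes> a') (\<beta>(Suc k := 1)) = \<sigma> (Suc k) (coef a' \<beta>) \<otimes> u" for a a'
    using a u i \<sigma>_facts(1)[OF i coef_closed[OF a(1)], of \<beta>] \<sigma>_facts(1)[OF i coef_closed[OF a(2)], of \<beta>]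
    by (simp add: r_distr coef_add eqs[unfolded One_nat_def] \<sigma>_facts(2)[OF i] l_distr)
  show "a \<in> stage k \<Longrightarrow> coef (x (Suc k) \<otimes> a) (\<beta>(Suc k := 1)) = \<sigma> (Suc k) (coef a \<beta>) \<otimes> u"
  proof (induction rule: stage_induct)
    case (piece a d)
    then show ?case
    proof (induction rule: piece_induct)
      case zero
      then show ?case using i u \<sigma>_zero by simp
    next
      case (summand r t \<alpha>)
      have r: "r \<in> carrier R" using summand(1) by (rule gr_R)
      obtain w where w: "w \<in> gr_units" "x (Suc k) \<otimes> monomial \<alpha> = w \<otimes> (monomial \<alpha> \<otimes> x (Suc k))"
        by (rule x_mono[OF k summand(2)])
      \<comment> \<open>\<open>x_mono\<close> yields some unit for \<alpha>, possibly another one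
        than the prescribed \<open>u\<close>. At the exponent \<beta> the prescribed factor must be
        taken; the other terms do not contribute to this coordinate.\<close>
      let ?w = "if \<alpha> = \<beta> then u else w"
      have w': "?w \<in> carrier R" "x (Suc k) \<otimes> monomial \<alpha> = ?w \<otimes> (monomial \<alpha> \<otimes> x (Suc k))"
        using w u eq gr_units_R[OF w(1)] by auto
      have s: "\<sigma> (Suc k) r \<otimes> ?w \<in> carrier R"
        by (rule R_closed(2)[OF \<sigma>_facts(1)[OF i r] w'(1)])
      have "coef (x (Suc k) \<otimes> (r \<otimes> monomial \<alpha>)) (\<beta>(Suc k := 1)) =
          coef (\<sigma> (Suc k) r \<otimes> ?w \<otimes> monomial \<alpha>) \<beta>"
        unfolding x_term[OF k summand(2) r w']
        using coef_mult_x_pow[OF k \<beta> term_stage[OF s summand(2)], of 1 1] i by simp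
      also have "\<dots> = \<sigma> (Suc k) (coef (r \<otimes> monomial \<alpha>) \<beta>) \<otimes> u"
        using coef_mono[OF s summand(2), of \<beta>] coef_mono[OF r summand(2), of \<beta>] \<sigma>_zero u by simp
      finally show ?case .
    qed (rule add)
  qed (rule add)
qed

text \<open>At each exponent cancel the common unit on the right, then use injectivity of
  \<sigma>.\<close>

lemma x_mult_cancel:
  assumes k: "k < n" and a: "a \<in> stage k" "a' \<in> stage k"
    and eq: "x (Suc k) \<otimes> a = x (Suc k) \<otimes> a'"
  shows "a = a'"
proof (rule coef_eqI)
  fix \<beta>
  have i: "1 \<le> Suc k" "Suc k \<le> n" using k by auto
  show "coef a \<beta> = coef a' \<beta>"
  proof (cases "\<beta> \<in> exps k")
    case True
    obtain u where u: "u \<in> gr_units" "x (Suc k) \<otimes> monomial \<beta> = u \<otimes> (monomial \<beta> \<otimes> x (Suc k))"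
      by (rule x_mono[OF k True])
    obtain v where v: "v \<in> carrier R" "u \<otimes> v = \<one>" by (rule gr_units_inverse[OF u(1)])
    have R: "coef a \<beta> \<in> carrier R" "coef a' \<beta> \<in> carrier R" using a stage_carrier by auto
    have "\<sigma> (Suc k) (coef a \<beta>) \<otimes> u = \<sigma> (Suc k) (coef a' \<beta>) \<otimes> u"
      using coef_x_mult[OF k True gr_units_R[OF u(1)] u(2)] a eq by metis
    then have "\<sigma> (Suc k) (coef a \<beta>) \<otimes> u \<otimes> v = \<sigma> (Suc k) (coef a' \<beta>) \<otimes> u \<otimes> v" by simp
    then have "\<sigma> (Suc k) (coef a \<beta>) = \<sigma> (Suc k) (coef a' \<beta>)"
      using \<sigma>_facts(1)[OF i R(1)] \<sigma>_facts(1)[OF i R(2)] gr_units_R[OF u(1)] v by (simp add: m_assoc)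
    then show ?thesis
      using \<sigma>_bij[OF i] R unfolding bij_betw_def inj_on_def by blast
  next
    case False
    then have "coef a \<beta> = \<zero>" "coef a' \<beta> = \<zero>" using a unfolding stage_def by blast+
    then show ?thesis by simp
  qed
qed (use a stage_carrier in auto)

text \<open>The automorphism \<theta> of stage \<open>k\<close>, conjugation by
  \<open>x (Suc k)\<close> although that variable is not invertible. Uniqueness of \<open>b\<close>
  is \<open>mult_x_cancel\<close>, existence is \<open>ex_twist\<close>.\<close>

definition twist :: "nat \<Rightarrow> 'a \<Rightarrow> 'a" where
  "twist k a = (THE b. b \<in> stage k \<and> x (Suc k) \<otimes> a = b \<otimes> x (Suc k))"

lemma twist_eqI:
  assumes "k < n" "b \<in> stage k" "x (Suc k) \<otimes> a = b \<otimes> x (Suc k)"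
  shows "twist k a = b"
  unfolding twist_def using assms mult_x_cancel[OF assms(1)] by (intro the_equality) metis+

lemma twist:
  assumes "k < n" "a \<in> stage k"
  shows "twist k a \<in> stage k" "x (Suc k) \<otimes> a = twist k a \<otimes> x (Suc k)"
  using ex_twist[OF assms] twist_eqI[OF assms(1)] by metis+

lemma twist_piece:
  assumes "k < n" "a \<in> piece k p"
  shows "twist k a \<in> piece k p"
  using ex_twist_piece[OF assms] twist_eqI[OF assms(1)] piece_stage by metis

lemma twist_bij:
  assumes k: "k < n"
  shows "bij_betw (twist k) (stage k) (stage k)"
proof (rule bij_betwI')
  fix a a' assume a: "a \<in> stage k" "a' \<in> stage k"
  show "twist k a = twist k a' \<longleftrightarrow> a = a'"
    using twist(2)[OF k a(1)] twist(2)[OF k a(2)] x_mult_cancel[OF k a] by metis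
next
  fix b assume "b \<in> stage k"
  then show "\<exists>a\<in>stage k. b = twist k a"
    using ex_untwist[OF k] twist_eqI[OF k] by metis
qed (use twist[OF k] in blast)

text \<open>In each case the right-hand side lies in the stage and solves the defining equation, so
  uniqueness identifies it with the value of \<open>twist\<close>.\<close>

lemma twist_hom:
  assumes k: "k < n" and a: "a \<in> stage k" and a': "a' \<in> stage k"
  shows "twist k (a \<oplus> a') = twist k a \<oplus> twist k a'"
    and "twist k (a \<otimes> a') = twist k a \<otimes> twist k a'"
    and "twist k \<one> = \<one>"
    and "s \<in> carrier K \<Longrightarrow> twist k (s \<odot> a) = s \<odot> twist k a"
proof -
  note t = twist[OF k a] and t' = twist[OF k a']
  have cl: "a \<in> carrier A" "a' \<in> carrier A" "twist k a \<in> carrier A" "twist k a' \<in> carrier A"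
    "x (Suc k) \<in> carrier A"
    using a a' t t' stage_carrier k by auto
  show "twist k (a \<oplus> a') = twist k a \<oplus> twist k a'"
    using add_stage[OF t(1) t'(1)] cl t(2) t'(2) by (intro twist_eqI[OF k]) (simp_all add: l_distr r_distr)
  have "x (Suc k) \<otimes> (a \<otimes> a') = (x (Suc k) \<otimes> a) \<otimes> a'" using cl by (simp add: m_assoc)
  also have "\<dots> = twist k a \<otimes> (x (Suc k) \<otimes> a')" using cl t(2) by (simp add: m_assoc)
  also have "\<dots> = twist k a \<otimes> twist k a' \<otimes> x (Suc k)" using cl t'(2) by (simp add: m_assoc)
  finally show "twist k (a \<otimes> a') = twist k a \<otimes> twist k a'"
    using mult_stage[OF _ t(1) t'(1)] k by (intro twist_eqI[OF k]) auto
  show "twist k \<one> = \<one>"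
    using R_stage[OF one_in_R, of k] cl by (intro twist_eqI[OF k]) auto
  show "twist k (s \<odot> a) = s \<odot> twist k a" if s: "s \<in> carrier K"
    using smult_stage[OF s t(1)] cl t(2) s AA.smult_mult_left[of s "twist k a" "x (Suc k)"]
      AA.smult_mult_right[of s "x (Suc k)" a]
    by (intro twist_eqI[OF k]) simp_all
qed

section \<open>The tower of Ore extensions\<close>

lemma subalg_ring_extension:
  assumes "subalg K S A"
  shows "ring_extension A S"
proof (intro ring_extension.intro ring_extension_axioms.intro)
  show "ring S" using assms by (auto simp: subalg_def k_algebra_def)
  show "carrier S \<subseteq> carrier A" "(\<lambda>a. a) \<in> ring_hom S A"
    using assms by (auto simp: subalg_def alg_hom_def)
qed (rule ring_axioms)

lemma subalg_smult: "\<lbrakk>subalg K S A; s \<in> carrier K; a \<in> carrier S\<rbrakk> \<Longrightarrow> s \<odot>\<^bsub>S\<^esub> a = s \<odot> a"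
  by (simp add: subalg_def alg_hom_def)

section \<open>The grading of a stage and its automorphism\<close>

lemma stage_sum_components:
  assumes "a \<in> stage k"
  shows "\<exists>d. \<exists>f\<in>(\<Pi> m\<in>{..d}. piece k m). a = (\<Oplus>m\<in>{..d}. f m)"
  using assms
proof (induction rule: stage_induct)
  case (piece a p)
  define f where "f = (\<lambda>m. if m = p then a else \<zero>)"
  have "f \<in> (\<Pi> m\<in>{..p}. piece k m)" using piece zero_piece by (auto simp: f_def)
  moreover have "(\<Oplus>m\<in>{..p}. f m) = a"
    unfolding f_def using add.finprod_singleton_swap[of p "{..p}" "\<lambda>_. a"] piece_carrier[OF piece]
    by simp
  ultimately show ?case by metis
next
  case (add a a')
  obtain d f where f: "f \<in> (\<Pi> m\<in>{..d}. piece k m)" "a = (\<Oplus>m\<in>{..d}. f m)"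
    using add(3) by blast
  obtain d' f' where f': "f' \<in> (\<Pi> m\<in>{..d'}. piece k m)" "a' = (\<Oplus>m\<in>{..d'}. f' m)"
    using add(4) by blast
  define g where "g = (\<lambda>m. if m \<le> d then f m else \<zero>)"
  define g' where "g' = (\<lambda>m. if m \<le> d' then f' m else \<zero>)"
  define e where "e = max d d'"
  have g: "g m \<in> piece k m" "g' m \<in> piece k m" for m
    using f(1) f'(1) zero_piece by (auto simp: g_def g'_def)
  have fc: "f \<in> {..d} \<rightarrow> carrier A" "f' \<in> {..d'} \<rightarrow> carrier A"
    using f(1) f'(1) piece_carrier by blast+
  have "a = (\<Oplus>m\<in>{..e}. g m)" "a' = (\<Oplus>m\<in>{..e}. g' m)"
    unfolding f(2) f'(2) g_def g'_def by (rule finsum_pad; use fc in \<open>simp add: e_def\<close>)+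
  moreover have "(\<Oplus>m\<in>{..e}. g m \<oplus> g' m) = (\<Oplus>m\<in>{..e}. g m) \<oplus> (\<Oplus>m\<in>{..e}. g' m)"
    by (rule finsum_addf) (use g piece_carrier in blast)+
  moreover have "(\<lambda>m. g m \<oplus> g' m) \<in> (\<Pi> m\<in>{..e}. piece k m)"
    using g add_piece by blast
  ultimately show ?case by metis
qed

text \<open>At a fixed exponent \<alpha> the coefficient of \<open>f j\<close> has degree
  \<open>j - wt \<alpha>\<close>, and it is zero when j is below \<open>wt \<alpha>\<close>. The
  coordinates therefore form a vanishing homogeneous sum in \<open>R\<close>.\<close>

lemma piece_independent:
  assumes f: "f \<in> (\<Pi> m\<in>{..d}. piece k m)" and sum: "(\<Oplus>m\<in>{..d}. f m) = \<zero>" and m: "m \<le> d"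
  shows "f m = \<zero>"
proof (rule coef_eqI)
  have fc: "f j \<in> carrier A" if "j \<le> d" for j
    using f that piece_carrier by blast
  show "f m \<in> carrier A" using fc m .
  fix \<alpha>
  let ?w = "wt \<alpha>"
  have low: "coef (f j) \<alpha> = \<zero>" if "j \<le> d" "j < ?w" for j
    using f that unfolding piece_def by fastforce
  have high: "coef (f j) \<alpha> \<in> gr (j - ?w)" if "j \<le> d" for j
  proof (cases "coef (f j) \<alpha> = \<zero>")
    case False
    moreover have "f j \<in> piece k j" using f that by auto
    ultimately show ?thesis unfolding piece_def by blast
  qed (simp add: gr_ops(1))
  show "coef (f m) \<alpha> = coef \<zero> \<alpha>"
  proof (cases "m < ?w")
    case True
    then show ?thesis using low m by simp
  next
    case False
    \<comment> \<open>Reindexing by \<open>t = j - wt \<alpha>\<close> makes the index equal to the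
      degree in \<open>R\<close>, as independence of the grading of \<open>R\<close>
      requires.\<close>
    define h where "h = (\<lambda>t. coef (f (t + ?w)) \<alpha>)"
    have w: "?w \<le> d" using False m by simp
    have h: "h \<in> (\<Pi> t\<in>{..d - ?w}. gr t)"
    proof
      fix t assume "t \<in> {..d - ?w}"
      then show "h t \<in> gr t" using high[of "t + ?w"] w by (simp add: h_def)
    qed
    have hR: "h \<in> {..d - ?w} \<rightarrow> carrier R" using h gr_R by blast
    have cR: "coef (f j) \<alpha> \<in> carrier A" if "j \<le> d" for j
      using R_carrier[OF coef_closed[OF fc[OF that]]] .
    have "(\<Oplus>t\<in>{..d - ?w}. h t) = (\<Oplus>j\<in>(\<lambda>t. t + ?w) ` {..d - ?w}. coef (f j) \<alpha>)"
      unfolding h_def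
    proof (rule finsum_reindex[symmetric])
      show "(\<lambda>j. coef (f j) \<alpha>) \<in> (\<lambda>t. t + ?w) ` {..d - ?w} \<rightarrow> carrier A"
        using cR w by auto
    qed (simp add: inj_on_def)
    also have "\<dots> = (\<Oplus>j\<in>{..d}. coef (f j) \<alpha>)"
    proof (rule add.finprod_mono_neutral_cong_left)
      fix j assume j: "j \<in> {..d} - (\<lambda>t. t + ?w) ` {..d - ?w}"
      have "j < ?w"
      proof (rule ccontr)
        assume "\<not> j < ?w"
        then have "j = (j - ?w) + ?w" "j - ?w \<in> {..d - ?w}" using j by auto
        then show False using j by blast
      qed
      then show "coef (f j) \<alpha> = \<zero>" using low j by simp
    qed (use cR w in auto)
    also have "\<dots> = coef (\<Oplus>j\<in>{..d}. f j) \<alpha>"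
      using fc by (intro coef_finsum[symmetric]) auto
    also have "\<dots> = \<zero>" using sum by simp
    finally have "(\<Oplus>\<^bsub>R\<^esub>t\<in>{..d - ?w}. h t) = \<zero>\<^bsub>R\<^esub>"
      using R_finsum[OF _ hR] by simp
    then have "h (m - ?w) = \<zero>\<^bsub>R\<^esub>"
      using GR.independent_components[OF h] m by simp
    then show ?thesis using False by (simp add: h_def)
  qed
qed simp

text \<open>Stated for an arbitrary subalgebra \<open>S\<close> with this carrier, because stage 0
  is represented by \<open>R\<close> and the later ones by restrictions of \<open>A\<close>.\<close>

lemma graded_stage:
  assumes k: "k \<le> n" and S: "subalg K S A" and carrier_S: "carrier S = stage k"
  shows "graded_algebra K S (piece k)"
proof -
  interpret S: ring_extension A S by (rule subalg_ring_extension[OF S])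
  have alg: "k_algebra K S" using S by (simp add: subalg_def)
  have module: "Module.module K S" using alg by (rule k_algebra.axioms)
  have in_S: "a \<in> carrier S" if "a \<in> piece k p" for a p
    using that carrier_S piece_stage by auto
  have finsum_S: "(\<Oplus>\<^bsub>S\<^esub>m\<in>{..d}. f m) = (\<Oplus>m\<in>{..d}. f m)"
    if "f \<in> (\<Pi> m\<in>{..d}. piece k m)" for f and d :: nat
    using that in_S by (intro S.R_finsum) blast+
  show ?thesis
  proof (intro graded_algebra.intro graded_algebra_axioms.intro alg)
    fix p
    show "submodule (piece k p) K S"
    proof (rule module.submoduleI[OF module])
      show "piece k p \<subseteq> carrier S" using in_S by blast
      show "\<zero>\<^bsub>S\<^esub> \<in> piece k p" using zero_piece by simp
      show "\<ominus>\<^bsub>S\<^esub> a \<in> piece k p" if "a \<in> piece k p" for a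
        using a_inv_piece[OF that] in_S[OF that] by simp
      show "a \<oplus>\<^bsub>S\<^esub> b \<in> piece k p" if "a \<in> piece k p" "b \<in> piece k p" for a b
        using add_piece[OF that] in_S that by simp
      show "s \<odot>\<^bsub>S\<^esub> a \<in> piece k p" if "s \<in> carrier K" "a \<in> piece k p" for s a
        using smult_piece[OF that] subalg_smult[OF S that(1) in_S[OF that(2)]] by simp
    qed
  next
    fix a assume "a \<in> carrier S"
    then obtain d f where f: "f \<in> (\<Pi> m\<in>{..d}. piece k m)" "a = (\<Oplus>m\<in>{..d}. f m)"
      using stage_sum_components carrier_S by blast
    then show "\<exists>d. \<exists>f\<in>(\<Pi> m\<in>{..d}. piece k m). a = (\<Oplus>\<^bsub>S\<^esub>m\<in>{..d}. f m)"
      using finsum_S[OF f(1)] by metis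
  next
    fix f and d m :: nat
    assume "f \<in> (\<Pi> m\<in>{..d}. piece k m)" "(\<Oplus>\<^bsub>S\<^esub>m\<in>{..d}. f m) = \<zero>\<^bsub>S\<^esub>" "m \<le> d"
    then show "f m = \<zero>\<^bsub>S\<^esub>" using piece_independent finsum_S by simp
  next
    fix a b p q assume ab: "a \<in> piece k p" "b \<in> piece k q"
    then show "a \<otimes>\<^bsub>S\<^esub> b \<in> piece k (p + q)"
      using mult_piece[OF k ab] in_S[OF ab(1)] in_S[OF ab(2)] by simp
  qed
qed

text \<open>\<open>ex_untwist\<close> carries no degree information; that each degree is mapped onto
  itself comes from \<open>additive_bij_image_gr\<close>.\<close>

lemma twist_graded_iso:
  assumes k: "k < n" and S: "subalg K S A" and carrier_S: "carrier S = stage k"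
  shows "twist k \<in> graded_alg_iso K S (piece k) S (piece k)"
proof -
  interpret S: ring_extension A S by (rule subalg_ring_extension[OF S])
  note one_stage = R_stage[OF one_in_R, of k]
  have "twist k \<in> ring_hom S S"
    by (rule ring_hom_memI) (use twist[OF k] twist_hom(1,2)[OF k] twist_hom(3)[OF k one_stage one_stage] carrier_S in auto)
  then have hom: "twist k \<in> alg_hom K S S"
    unfolding alg_hom_def
    using twist(1)[OF k] twist_hom(4)[OF k _ one_stage] subalg_smult[OF S] carrier_S by simp
  have bij: "bij_betw (twist k) (carrier S) (carrier S)"
    using twist_bij[OF k] carrier_S by simp
  moreover have "twist k ` piece k m = piece k m" for m
  proof (rule graded_algebra.additive_bij_image_gr[OF graded_stage[OF _ S carrier_S] bij])
    show "twist k (a \<oplus>\<^bsub>S\<^esub> b) = twist k a \<oplus>\<^bsub>S\<^esub> twist k b" if "a \<in> carrier S" "b \<in> carrier S" for a b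
      using that twist(1)[OF k] twist_hom(1)[OF k] carrier_S by simp
    show "twist k ` piece k p \<subseteq> piece k p" for p
      using twist_piece[OF k] by blast
  qed (use k in simp)
  ultimately show ?thesis using hom by (simp add: graded_alg_iso_def)
qed

section \<open>Powers of the next variable as a basis\<close>

lemma stage_Suc_expansion:
  assumes k: "k < n" and a: "a \<in> stage (Suc k)"
  shows "\<exists>f d. (\<forall>q. f q \<in> stage k) \<and> (\<forall>q>d. f q = \<zero>) \<and>
    a = (\<Oplus>q\<in>{..d :: nat}. f q \<otimes> x (Suc k) [^] q)" (is "?P a")
proof -
  have x: "x (Suc k) \<in> carrier A" using k by simp
  \<comment> \<open>The coefficient families are total and vanish beyond their bounds, so both sums
    extend to the larger bound and add termwise.\<close>
  have add: "?P (a \<oplus> a')" if "?P a" "?P a'" for a a'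
  proof -
    obtain f d where f: "\<forall>q. f q \<in> stage k" "\<forall>q>d. f q = \<zero>"
      "a = (\<Oplus>q\<in>{..d :: nat}. f q \<otimes> x (Suc k) [^] q)" using \<open>?P a\<close> by blast
    obtain f' d' where f': "\<forall>q. f' q \<in> stage k" "\<forall>q>d'. f' q = \<zero>"
      "a' = (\<Oplus>q\<in>{..d' :: nat}. f' q \<otimes> x (Suc k) [^] q)" using \<open>?P a'\<close> by blast
    have cl: "f q \<in> carrier A" "f' q \<in> carrier A" for q
      using f(1) f'(1) stage_carrier by blast+
    let ?e = "max d d'"
    have "a = (\<Oplus>q\<in>{..?e}. f q \<otimes> x (Suc k) [^] q)"
      unfolding f(3) using f(2) cl x by (intro add.finprod_mono_neutral_cong_left) auto
    moreover have "a' = (\<Oplus>q\<in>{..?e}. f' q \<otimes> x (Suc k) [^] q)"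
      unfolding f'(3) using f'(2) cl x by (intro add.finprod_mono_neutral_cong_left) auto
    moreover have "(\<Oplus>q\<in>{..?e}. f q \<otimes> x (Suc k) [^] q \<oplus> f' q \<otimes> x (Suc k) [^] q) =
        (\<Oplus>q\<in>{..?e}. f q \<otimes> x (Suc k) [^] q) \<oplus> (\<Oplus>q\<in>{..?e}. f' q \<otimes> x (Suc k) [^] q)"
      using cl x by (intro finsum_addf) auto
    moreover have "(\<Oplus>q\<in>{..?e}. f q \<otimes> x (Suc k) [^] q \<oplus> f' q \<otimes> x (Suc k) [^] q) =
        (\<Oplus>q\<in>{..?e}. (f q \<oplus> f' q) \<otimes> x (Suc k) [^] q)"
      using cl x by (intro finsum_cong') (auto simp: l_distr)
    ultimately have "a \<oplus> a' = (\<Oplus>q\<in>{..?e}. (f q \<oplus> f' q) \<otimes> x (Suc k) [^] q)" by simp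
    then show ?thesis
      using f(1,2) f'(1,2) add_stage by (intro exI[of _ "\<lambda>q. f q \<oplus> f' q"] exI[of _ ?e]) auto
  qed
  have single: "?P (b \<otimes> x (Suc k) [^] q)" if b: "b \<in> stage k" for b and q :: nat
  proof -
    define f where "f = (\<lambda>i. if i = q then b else \<zero>)"
    have bA: "b \<in> carrier A" using b by (rule stage_carrier)
    have "(\<Oplus>i\<in>{..q}. f i \<otimes> x (Suc k) [^] i) =
        (\<Oplus>i\<in>{..q}. if i = q then b \<otimes> x (Suc k) [^] i else \<zero>)"
      using bA x by (intro finsum_cong') (auto simp: f_def)
    also have "\<dots> = b \<otimes> x (Suc k) [^] q"
      using bA x add.finprod_singleton_swap[of q "{..q}" "\<lambda>i. b \<otimes> x (Suc k) [^] i"] by simp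
    finally have "b \<otimes> x (Suc k) [^] q = (\<Oplus>i\<in>{..q}. f i \<otimes> x (Suc k) [^] i)" ..
    moreover have "\<forall>i. f i \<in> stage k" "\<forall>i>q. f i = \<zero>"
      using b R_stage[OF zero_in_R] by (auto simp: f_def)
    ultimately show ?thesis by blast
  qed
  from a show ?thesis
  proof (induction rule: stage_induct)
    case (add a a')
    from add(3,4) show ?case by (rule \<open>\<And>a a'. ?P a \<Longrightarrow> ?P a' \<Longrightarrow> ?P (a \<oplus> a')\<close>)
  next
    case (piece a p)
    from k piece show ?case
    proof (induction rule: piece_Suc_induct)
      case zero
      show ?case using single[OF R_stage[OF zero_in_R], of 0] x by simp
    next
      case (add a a')
      from add(3,4) show ?case by (rule \<open>\<And>a a'. ?P a \<Longrightarrow> ?P a' \<Longrightarrow> ?P (a \<oplus> a')\<close>)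
    next
      case (summand b t q)
      show ?case by (rule single[OF piece_stage[OF summand(1)]])
    qed
  qed
qed

text \<open>Reading the coefficient at \<beta> with last exponent \<open>p\<close> isolates the
  summand with q = p, since distinct powers contribute to disjoint sets of monomials.\<close>

lemma stage_Suc_independent:
  assumes k: "k < n" and F: "finite F" and f: "f \<in> F \<rightarrow> stage k"
    and sum: "(\<Oplus>q\<in>F. f q \<otimes> x (Suc k) [^] (q :: nat)) = \<zero>" and p: "p \<in> F"
  shows "f p = \<zero>"
proof (rule coef_eqI)
  have x: "x (Suc k) \<in> carrier A" using k by simp
  have fc: "f q \<in> carrier A" if "q \<in> F" for q using f that stage_carrier by blast
  show "f p \<in> carrier A" using fc[OF p] .
  fix \<beta>
  show "coef (f p) \<beta> = coef \<zero> \<beta>"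
  proof (cases "\<beta> \<in> exps k")
    case True
    let ?g = "\<beta>(Suc k := p)"
    have "\<zero> = coef (\<Oplus>q\<in>F. f q \<otimes> x (Suc k) [^] q) ?g" using sum by simp
    also have "\<dots> = (\<Oplus>q\<in>F. coef (f q \<otimes> x (Suc k) [^] q) ?g)"
      using F fc x by (intro coef_finsum) auto
    also have "\<dots> = (\<Oplus>q\<in>F. if p = q then coef (f q) \<beta> else \<zero>)"
    proof (rule finsum_cong')
      fix q assume "q \<in> F"
      then have "f q \<in> stage k" using f by auto
      then show "coef (f q \<otimes> x (Suc k) [^] q) ?g = (if p = q then coef (f q) \<beta> else \<zero>)"
        by (rule coef_mult_x_pow[OF k True])
    qed (use fc in auto)
    also have "\<dots> = coef (f p) \<beta>"
      using fc by (intro add.finprod_singleton p F) auto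
    finally have "coef (f p) \<beta> = \<zero>" by (rule sym)
    then show ?thesis by simp
  next
    case False
    moreover have "f p \<in> stage k" using f p by auto
    ultimately have "coef (f p) \<beta> = \<zero>" unfolding stage_def by blast
    then show ?thesis by simp
  qed
qed simp

lemma ore_extension_stage:
  assumes k: "k < n"
    and S: "subalg K S A" "carrier S = stage k"
    and C: "subalg K C A" "carrier C = stage (Suc k)"
  shows "ore_extension K S (twist k) (\<lambda>_. \<zero>\<^bsub>S\<^esub>) (x (Suc k)) C"
proof -
  interpret S: ring_extension A S by (rule subalg_ring_extension[OF S(1)])
  interpret C: ring_extension A C by (rule subalg_ring_extension[OF C(1)])
  interpret C_ring: ring C by (rule C.ring_R)
  have x: "x (Suc k) \<in> carrier A" "x (Suc k) \<in> carrier C"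
    using k C(2) x_piece[of "Suc k" "Suc k"] piece_stage by auto
  have SC: "a \<in> carrier C" if "a \<in> carrier S" for a
    using that S(2) C(2) stage_mono[of k "Suc k"] by (simp add: subset_iff)
  have pow: "x (Suc k) [^]\<^bsub>C\<^esub> q = x (Suc k) [^] q \<and> x (Suc k) [^] q \<in> carrier C" for q :: nat
  proof (induction q)
    case (Suc q)
    then show ?case using x C.R_closed(2)[of "x (Suc k) [^] q" "x (Suc k)"] by simp
  qed simp
  have sub: "subalg K S C"
    unfolding subalg_def
  proof (intro conjI)
    show "k_algebra K S" "k_algebra K C" using S(1) C(1) by (simp_all add: subalg_def)
    show "carrier S \<subseteq> carrier C" using SC by blast
    have "(\<lambda>a. a) \<in> ring_hom S C"
      by (rule ring_hom_memI) (simp_all add: SC)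
    then show "(\<lambda>a. a) \<in> alg_hom K S C"
      by (simp add: alg_hom_def SC subalg_smult[OF S(1)] subalg_smult[OF C(1)])
  qed
  \<comment> \<open>\<open>left_basis\<close> is phrased with the operations of \<open>C\<close>.
    Existence and independence of expansions are both transferred to sums in
    \<open>A\<close>.\<close>
  have sum: "(\<Oplus>\<^bsub>C\<^esub>q\<in>F. f q \<otimes>\<^bsub>C\<^esub> x (Suc k) [^]\<^bsub>C\<^esub> q) = (\<Oplus>q\<in>F. f q \<otimes> x (Suc k) [^] q)"
    if F: "finite F" and f: "f \<in> F \<rightarrow> carrier S" for F :: "nat set" and f
  proof -
    have fC: "f q \<in> carrier C" if "q \<in> F" for q using f that SC by auto
    have summand: "f q \<otimes>\<^bsub>C\<^esub> x (Suc k) [^]\<^bsub>C\<^esub> q = f q \<otimes> x (Suc k) [^] q" if "q \<in> F" for q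
      using fC[OF that] pow[of q] by simp
    have "(\<Oplus>\<^bsub>C\<^esub>q\<in>F. f q \<otimes>\<^bsub>C\<^esub> x (Suc k) [^]\<^bsub>C\<^esub> q) = (\<Oplus>q\<in>F. f q \<otimes>\<^bsub>C\<^esub> x (Suc k) [^]\<^bsub>C\<^esub> q)"
      using fC pow summand C.R_closed(2) by (intro C.R_finsum F) auto
    also have "\<dots> = (\<Oplus>q\<in>F. f q \<otimes> x (Suc k) [^] q)"
      using fC pow x(1) summand by (intro finsum_cong') auto
    finally show ?thesis .
  qed
  have basis: "left_basis S C UNIV (\<lambda>q. x (Suc k) [^]\<^bsub>C\<^esub> (q :: nat))"
    unfolding left_basis_def
  proof (intro conjI ballI allI impI)
    show "(\<lambda>q. x (Suc k) [^]\<^bsub>C\<^esub> (q :: nat)) \<in> UNIV \<rightarrow> carrier C" using pow by simp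
  next
    fix a assume "a \<in> carrier C"
    then have "a \<in> stage (Suc k)" using C(2) by simp
    from stage_Suc_expansion[OF k this] obtain f d where f: "\<forall>q. f q \<in> stage k"
      "a = (\<Oplus>q\<in>{..d :: nat}. f q \<otimes> x (Suc k) [^] q)"
      by blast
    have fS: "f \<in> {..d} \<rightarrow> carrier S" using f(1) S(2) by simp
    have "a = (\<Oplus>\<^bsub>C\<^esub>q\<in>{..d}. f q \<otimes>\<^bsub>C\<^esub> x (Suc k) [^]\<^bsub>C\<^esub> q)"
      unfolding f(2) by (rule sum[OF _ fS, symmetric]) simp
    then have w: "finite {..d} \<and> {..d} \<subseteq> UNIV \<and> f \<in> {..d} \<rightarrow> carrier S \<and>
        a = (\<Oplus>\<^bsub>C\<^esub>q\<in>{..d}. f q \<otimes>\<^bsub>C\<^esub> x (Suc k) [^]\<^bsub>C\<^esub> q)"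
      by (intro conjI finite_atMost subset_UNIV fS)
    show "\<exists>(F :: nat set) f. finite F \<and> F \<subseteq> UNIV \<and> f \<in> F \<rightarrow> carrier S \<and>
        a = (\<Oplus>\<^bsub>C\<^esub>q\<in>F. f q \<otimes>\<^bsub>C\<^esub> x (Suc k) [^]\<^bsub>C\<^esub> q)"
      by (rule exI[of _ "{..d}"], rule exI[of _ f], rule w)
  next
    fix F :: "nat set" and f q
    assume h: "finite F \<and> F \<subseteq> UNIV \<and> f \<in> F \<rightarrow> carrier S \<and>
      (\<Oplus>\<^bsub>C\<^esub>q\<in>F. f q \<otimes>\<^bsub>C\<^esub> x (Suc k) [^]\<^bsub>C\<^esub> q) = \<zero>\<^bsub>C\<^esub>" and q: "q \<in> F"
    note F = h[THEN conjunct1] h[THEN conjunct2, THEN conjunct2, THEN conjunct1]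
      h[THEN conjunct2, THEN conjunct2, THEN conjunct2]
    have "(\<Oplus>q\<in>F. f q \<otimes> x (Suc k) [^] q) = \<zero>"
      using F(3) unfolding sum[OF F(1,2)] C.R_zero .
    moreover have "f \<in> F \<rightarrow> stage k" using F(2) S(2) by simp
    ultimately show "f q = \<zero>\<^bsub>S\<^esub>"
      unfolding S.R_zero using stage_Suc_independent[where f = f, OF k F(1)] q by blast
  qed
  have "twist k \<in> ring_hom S S"
    using twist_graded_iso[OF k S] by (simp add: graded_alg_iso_def alg_hom_def)
  moreover have "skew_derivation S (twist k) (\<lambda>_. \<zero>\<^bsub>S\<^esub>)"
  proof -
    have "twist k a \<in> carrier S" if "a \<in> carrier S" for a using twist(1)[OF k] that S(2) by simp
    then show ?thesis unfolding skew_derivation_def by simp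
  qed
  moreover have "x (Suc k) \<otimes>\<^bsub>C\<^esub> a = twist k a \<otimes>\<^bsub>C\<^esub> x (Suc k) \<oplus>\<^bsub>C\<^esub> \<zero>\<^bsub>S\<^esub>" if a: "a \<in> carrier S" for a
  proof -
    have t: "twist k a \<in> carrier S" "x (Suc k) \<otimes> a = twist k a \<otimes> x (Suc k)"
      using twist[OF k] a S(2) by auto
    have "twist k a \<otimes> x (Suc k) \<in> carrier C" using C.R_closed(2)[OF SC[OF t(1)] x(2)] .
    then show ?thesis using t SC[OF a] SC[OF t(1)] x by simp
  qed
  ultimately show ?thesis
    unfolding ore_extension_def using sub x(2) basis by blast
qed

text \<open>\<open>S\<close> is \<open>R\<close> at the bottom and \<open>A\<close> with restricted
  carrier above. Carrying along that it is a subalgebra of \<open>A\<close> with carrier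
  \<open>stage k\<close> is enough for the next step.\<close>

lemma iterated_ore_stage:
  assumes "k \<le> n"
  shows "\<exists>S. graded_iterated_ore_endo K R gr S (piece k) \<and> subalg K S A \<and> carrier S = stage k"
  using assms
proof (induction k)
  case 0
  have "piece 0 = gr" using piece_0 by blast
  moreover have "k_algebra K R" by (rule GR.k_algebra_axioms)
  then have "subalg K R A"
    using alg_A carrier_R incl_alg_hom by (simp add: subalg_def)
  ultimately show ?case
    using graded_iterated_ore_endo.base[OF graded_R] stage_0 by (intro exI[of _ R]) simp
next
  case (Suc k)
  then have k: "k < n" by simp
  obtain S where S: "graded_iterated_ore_endo K R gr S (piece k)" "subalg K S A" "carrier S = stage k"
    using Suc by auto
  let ?C = "A\<lparr>carrier := stage (Suc k)\<rparr>"
  have C: "subalg K ?C A" "carrier ?C = stage (Suc k)"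
    using subalg_stage[OF Suc.prems] by simp_all
  have "graded_iterated_ore_endo K R gr ?C (piece (Suc k))"
    using S(1) twist_graded_iso[OF k S(2,3)] ore_extension_stage[OF k S(2,3) C]
      graded_stage[OF Suc.prems C]
  proof (rule graded_iterated_ore_endo.step)
    show "\<forall>m. piece k m \<subseteq> piece (Suc k) m" using piece_mono[of k "Suc k"] by simp
    show "x (Suc k) \<in> piece (Suc k) 1" using Suc.prems by (intro x_piece) auto
  qed
  with C show ?case by blast
qed

text \<open>The generators of the span have the prescribed coefficients; conversely
  \<open>piece_induct\<close> writes every element of the piece as a sum of generators, whose
  coefficients already range over the whole spaces \<open>gr t\<close>.\<close>

lemma skew_PBW_grading_eq_piece: "skew_PBW_grading K gr A n x = piece n"
proof
  fix p
  let ?X = "{r \<otimes> monomial \<alpha> | r t \<alpha>. \<alpha> \<in> exponents n \<and> r \<in> gr t \<and> t + (\<Sum>i\<in>{1..n}. \<alpha> i) = p}"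
  have "submodule (piece n p) K A"
    by (intro AA.M.submoduleI zero_piece a_inv_piece add_piece smult_piece)
      (auto dest: piece_carrier)
  moreover have "?X \<subseteq> piece n p"
    using term_piece by (auto simp: exps_n wt_def)
  moreover have "piece n p \<subseteq> H" if H: "submodule H K A" "?X \<subseteq> H" for H
  proof
    fix a assume "a \<in> piece n p"
    then show "a \<in> H"
    proof (induction rule: piece_induct)
      case zero
      show ?case using subgroup.one_closed[OF submodule.axioms(1)[OF H(1)]] by simp
    next
      case (add a a')
      then show ?case using AA.M.submoduleE(5)[OF H(1)] by blast
    next
      case (summand r t \<alpha>)
      then show ?case using H(2) by (auto simp: exps_n wt_def)
    qed
  qed
  ultimately show "skew_PBW_grading K gr A n x p = piece n p"
    unfolding skew_PBW_grading_def lin_span_def by blast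
qed

text \<open>\<open>S\<close> has the carrier of \<open>A\<close> but may be another record (it is
  \<open>R\<close> when n = 0), so the identity map still has to be checked to be an
  isomorphism.\<close>

lemma graded_iterated_ore:
  "\<exists>(B :: ('k, 'a) module) gB. graded_iterated_ore_endo K R gr B gB \<and>
     graded_alg_iso K A (skew_PBW_grading K gr A n x) B gB \<noteq> {}"
proof -
  obtain S where S: "graded_iterated_ore_endo K R gr S (piece n)" "subalg K S A" "carrier S = carrier A"
    using iterated_ore_stage[of n] stage_n by auto
  interpret S: ring_extension A S by (rule subalg_ring_extension[OF S(2)])
  have "(\<lambda>a. a) \<in> alg_hom K A S"
    unfolding alg_hom_def using S(3) subalg_smult[OF S(2)] by (auto intro!: ring_hom_memI)
  then have "(\<lambda>a. a) \<in> graded_alg_iso K A (skew_PBW_grading K gr A n x) S (piece n)"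
    unfolding graded_alg_iso_def skew_PBW_grading_eq_piece using S(3)
    by (simp add: bij_betw_def inj_on_def)
  with S(1) show ?thesis by blast
qed

end

section \<open>Matching the quasi-commutativity relations with the graded data\<close>

theorem proposition2p11:
  fixes K :: "('k, 'l) ring_scheme"
    and R A :: "('k, 'a) module"
    and gr :: "nat \<Rightarrow> 'a set"
    and n :: nat
    and x :: "nat \<Rightarrow> 'a"
  assumes "field K"
    and "graded_algebra K R gr"
    and "graded_skew_PBW_extension K R gr A n x"
    and "quasi_commutative R A n x"
  shows "\<exists>(B :: ('k, 'a) module) gB.
           graded_iterated_ore_endo K R gr B gB \<and>
           graded_alg_iso K A (skew_PBW_grading K gr A n x) B gB \<noteq> {}"
proof -
  from assms(3) obtain \<sigma> \<delta> c where pbw: "skew_PBW_extension K R A n x"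
    and data: "skew_PBW_data R A n x \<sigma> \<delta> c" "bijective_data R n \<sigma> c" "graded_data A gr n x \<sigma> \<delta> c"
    unfolding graded_skew_PBW_extension_def by blast
  have sub: "subalg K R A" and x: "x \<in> {1..n} \<rightarrow> carrier A"
    and basis: "left_basis R A (exponents n) (std_mono A x n)"
    using pbw unfolding skew_PBW_extension_def by blast+
  have alg: "k_algebra K R" "k_algebra K A" and incl: "(\<lambda>a. a) \<in> alg_hom K R A"
    and carrier: "carrier R \<subseteq> carrier A"
    using sub unfolding subalg_def by blast+
  have rings: "ring R" "ring A" using alg by (auto simp: k_algebra_def)
  have incl': "(\<lambda>a. a) \<in> ring_hom R A" using incl by (simp add: alg_hom_def)
  interpret PBW_basis A R n x
    by (intro PBW_basis.intro free_extension.intro ring_extension.intro ring_extension_axioms.intro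
        free_extension_axioms.intro PBW_basis_axioms.intro rings carrier incl' basis x)
  have \<sigma>: "\<sigma> i \<in> ring_hom R R" "\<delta> i \<in> carrier R \<rightarrow> carrier R"
    "\<And>r. r \<in> carrier R \<Longrightarrow> x i \<otimes>\<^bsub>A\<^esub> r = \<sigma> i r \<otimes>\<^bsub>A\<^esub> x i \<oplus>\<^bsub>A\<^esub> \<delta> i r"
    if "1 \<le> i" "i \<le> n" for i
    using data(1) that unfolding skew_PBW_data_def skew_derivation_def by auto
  \<comment> \<open>Quasi-commutativity yields \<open>x i r = c x i\<close> with its own
    \<open>c\<close>, and only for nonzero \<open>r\<close>. Comparison with
    \<open>\<sigma> i r x i + \<delta> i r\<close> makes the derivation term vanish; for r = 0 both
    sides are zero.\<close>
  have x_R: "x i \<otimes>\<^bsub>A\<^esub> r = \<sigma> i r \<otimes>\<^bsub>A\<^esub> x i" if i: "1 \<le> i" "i \<le> n" and r: "r \<in> carrier R" for i r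
  proof (cases "r = \<zero>\<^bsub>A\<^esub>")
    case True
    have "\<sigma> i \<zero>\<^bsub>R\<^esub> = \<zero>\<^bsub>R\<^esub>" using ring_hom_zero[OF \<sigma>(1)[OF i] rings(1) rings(1)] .
    then show ?thesis using True i by simp
  next
    case False
    then have "i \<in> {1..n}" "r \<in> carrier R - {\<zero>\<^bsub>R\<^esub>}" using i r by auto
    then obtain c where c: "c \<in> carrier R" "x i \<otimes>\<^bsub>A\<^esub> r = c \<otimes>\<^bsub>A\<^esub> x i"
      using assms(4) unfolding quasi_commutative_def by blast
    have R: "\<sigma> i r \<in> carrier R" "\<delta> i r \<in> carrier R"
      using \<sigma>(1,2)[OF i] r by (auto simp: ring_hom_def)
    have "\<delta> i r = \<zero>\<^bsub>A\<^esub>"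
      using derivation_zeroI[OF i R c(1)] \<sigma>(3)[OF i r] c(2) by simp
    then show ?thesis using \<sigma>(3)[OF i r] R i by simp
  qed
  \<comment> \<open>Quasi-commutativity gives the relation for some c', while invertibility and
    degree 0 are known for \<open>c i j\<close>; freeness shows that the two constants
    coincide.\<close>
  have x_x: "x j \<otimes>\<^bsub>A\<^esub> x i = c i j \<otimes>\<^bsub>A\<^esub> (x i \<otimes>\<^bsub>A\<^esub> x j)" if ij: "1 \<le> i" "i < j" "j \<le> n" for i j
  proof -
    have "i \<in> {1..n}" "j \<in> {1..n}" using ij by auto
    then obtain c' where c': "c' \<in> carrier R" "x j \<otimes>\<^bsub>A\<^esub> x i = c' \<otimes>\<^bsub>A\<^esub> (x i \<otimes>\<^bsub>A\<^esub> x j)"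
      using assms(4) unfolding quasi_commutative_def by blast
    have c: "c i j \<in> carrier R"
      "x j \<otimes>\<^bsub>A\<^esub> x i \<ominus>\<^bsub>A\<^esub> c i j \<otimes>\<^bsub>A\<^esub> (x i \<otimes>\<^bsub>A\<^esub> x j) \<in> affine_part A n x (carrier R) (carrier R)"
      using data(1) ij unfolding skew_PBW_data_def by auto
    have "c' = c i j" by (rule structure_constant_unique[OF ij c(1) c'(1) c(2) c'(2)])
    with c'(2) show ?thesis by simp
  qed
  interpret graded_quasi_commutative K A R n x gr \<sigma> c
  proof (intro graded_quasi_commutative.intro graded_quasi_commutative_axioms.intro PBW_basis_axioms)
    show "graded_algebra K R gr" by (rule assms(2))
    show "k_algebra K A" "(\<lambda>a. a) \<in> alg_hom K R A" by (rule alg incl)+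
    show "bij_betw (\<sigma> i) (carrier R) (carrier R)" if "1 \<le> i" "i \<le> n" for i
      using data(2) that unfolding bijective_data_def by simp
    show "\<sigma> i r \<in> gr m" if "1 \<le> i" "i \<le> n" "r \<in> gr m" for i r m
      using data(3) that unfolding graded_data_def by fastforce
    show "c i j \<in> Units R \<inter> gr 0" if "1 \<le> i" "i < j" "j \<le> n" for i j
      using data(2,3) that unfolding graded_data_def bijective_data_def by auto
  qed (use \<sigma>(1) x_R x_x in blast)+
  show ?thesis by (rule graded_iterated_ore)
qed

end
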